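(* Let $k\ge 2$ be an integer, let $\mathbb{K}$ be the field of complex numbers or the field of real numbers, and let $n\in\mathbb{N}$. Then every element of $SL_n(\mathbb{K})$ can be written as a product of at most $4k-6$ commutators of elements of order $k$ in $GL_n(\mathbb{K})$.
   Context: Convention: an element $g$ of a group is said to be "of order $k$" if $g^k=1$. The commutator is $[\alpha,\beta]=\alpha\beta\alpha^{-1}\beta^{-1}$; a "commutator of elements of order $k$" is a commutator $[\alpha,\beta]$ with $\alpha^k=\beta^k=1$. *)

theory Defs
  imports Complex_Main "Jordan_Normal_Form.Determinant" "HOL-Algebra.Generated_Groups"
begin

definition GL :: "'a::field itself \<Rightarrow> nat \<Rightarrow> 'a mat monoid" where
  "GL K n = units_of (ring_mat K n ())"

definition SL :: "'a::field itself \<Rightarrow> nat \<Rightarrow> 'a mat set" where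
  "SL K n = {A \<in> carrier_mat n n. det A = 1}"

text \<open>An element of order \<open>k\<close> is one with \<open>g\<^sup>k = 1\<close>; its exact order, \<open>group.ord\<close>,
  may be a proper divisor of \<open>k\<close>.\<close>

definition elements_of_order :: "('g, 'b) monoid_scheme \<Rightarrow> nat \<Rightarrow> 'g set" where
  "elements_of_order G k = {g \<in> carrier G. g [^]\<^bsub>G\<^esub> k = \<one>\<^bsub>G\<^esub>}"

text \<open>\<open>derived_set G H\<close> is the set of all commutators \<open>a b a\<^sup>-\<^sup>1 b\<^sup>-\<^sup>1\<close> with
  \<open>a, b \<in> H\<close>, not the subgroup they generate.\<close>

definition commutators_of_order :: "('g, 'b) monoid_scheme \<Rightarrow> nat \<Rightarrow> 'g set" where
  "commutators_of_order G k = derived_set G (elements_of_order G k)"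

definition products_of_at_most :: "('g, 'b) monoid_scheme \<Rightarrow> nat \<Rightarrow> 'g set \<Rightarrow> 'g set" where
  "products_of_at_most G m S =
     {foldr (\<otimes>\<^bsub>G\<^esub>) gs \<one>\<^bsub>G\<^esub> | gs. set gs \<subseteq> S \<and> length gs \<le> m}"

end

theory Submission
  imports Defs "Jordan_Normal_Form.Column_Operations"
begin

text \<open>
  A commutator of two real rotations of order \<open>k\<close>, one of them conjugated by \<open>diag(p, 1)\<close>, has
  trace \<open>2 + sin\<^sup>4 x (p - 1/p)\<^sup>2\<close>, hence is similar to \<open>diag(r\<^sup>2, r\<^sup>-\<^sup>2)\<close> for any prescribed \<open>r > 1\<close>
  (for even \<open>k\<close>, involutions do as well). Block sums give a single commutator \<open>D\<close> in \<open>GL\<^sub>n\<close> that is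
  diagonal with distinct positive entries of product \<open>1\<close>. By Sourour's factorisation theorem, every
  nonscalar matrix of determinant \<open>1\<close> is a product of two matrices similar to \<open>D\<close>, that is, of two
  commutators. A scalar matrix is a product of two nonscalar ones, which is enough for \<open>k \<ge> 3\<close>
  since then \<open>4 \<le> 4 * k - 6\<close>; for \<open>k = 2\<close> it is a product of at most two diagonal commutators of
  monomial involutions.
\<close>

section \<open>Commutators in the general linear group\<close>


lemma GL_simps:
  "carrier (GL TYPE('a::field) n) = {A \<in> carrier_mat n n. \<exists>B \<in> carrier_mat n n. B * A = 1\<^sub>m n \<and> A * B = 1\<^sub>m n}"
  "mult (GL TYPE('a) n) = (*)"
  "one (GL TYPE('a) n) = 1\<^sub>m n"
  unfolding GL_def units_of_def Units_def ring_mat_def by auto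

lemma group_GL: "group (GL TYPE('a::field) n)"
proof -
  interpret ring "ring_mat TYPE('a) n ()" by (rule ring_mat)
  show ?thesis unfolding GL_def by (rule units_group)
qed

lemma pow_GL: "A [^]\<^bsub>GL TYPE('a::field) n\<^esub> (k::nat) = A ^\<^sub>m k" if "A \<in> carrier_mat n n"
proof (induct k)
  case 0
  interpret group "GL TYPE('a::field) n" by (rule group_GL)
  show ?case using that nat_pow_0[of A] by (simp add: GL_simps)
next
  case (Suc k)
  interpret group "GL TYPE('a::field) n" by (rule group_GL)
  show ?case using Suc nat_pow_Suc[of A k] by (simp add: GL_simps)
qed

lemma inv_GL:
  assumes "A \<in> carrier_mat n n" "B \<in> carrier_mat n n" "A * B = 1\<^sub>m n"
  shows "inv\<^bsub>GL TYPE('a::field) n\<^esub> A = B" "A \<in> carrier (GL TYPE('a) n)"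
proof -
  interpret group "GL TYPE('a) n" by (rule group_GL)
  have "B * A = 1\<^sub>m n" using mat_mult_left_right_inverse[OF assms] .
  then show "inv\<^bsub>GL TYPE('a) n\<^esub> A = B" "A \<in> carrier (GL TYPE('a) n)"
    using assms by (auto intro!: inv_equality simp: GL_simps)
qed

text \<open>A one-sided inverse of a square matrix over a field is two-sided, so the group inverses
  can be traded for explicit matrices \<open>a'\<close> and \<open>b'\<close>. Everything after this
  only has to verify matrix identities.\<close>

lemma commutators_of_order_iff:
  fixes M :: "'a::field mat"
  shows "M \<in> commutators_of_order (GL TYPE('a) n) k \<longleftrightarrow>
    (\<exists>a a' b b'. a \<in> carrier_mat n n \<and> a' \<in> carrier_mat n n \<and> b \<in> carrier_mat n n \<and>
      b' \<in> carrier_mat n n \<and> a * a' = 1\<^sub>m n \<and> b * b' = 1\<^sub>m n \<and>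
      a ^\<^sub>m k = 1\<^sub>m n \<and> b ^\<^sub>m k = 1\<^sub>m n \<and> M = a * b * a' * b')"  (is "?l \<longleftrightarrow> ?r")
proof
  interpret group "GL TYPE('a) n" by (rule group_GL)
  assume ?l
  then obtain a b where ab: "a \<in> carrier (GL TYPE('a) n)" "b \<in> carrier (GL TYPE('a) n)"
    and pow: "a [^]\<^bsub>GL TYPE('a) n\<^esub> k = 1\<^sub>m n" "b [^]\<^bsub>GL TYPE('a) n\<^esub> k = 1\<^sub>m n"
    and M: "M = a * b * inv\<^bsub>GL TYPE('a) n\<^esub> a * inv\<^bsub>GL TYPE('a) n\<^esub> b"
    unfolding commutators_of_order_def elements_of_order_def by (auto simp: GL_simps(2,3))
  obtain a' b' where *: "a \<in> carrier_mat n n" "a' \<in> carrier_mat n n" "b \<in> carrier_mat n n"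
     "b' \<in> carrier_mat n n" "a * a' = 1\<^sub>m n" "b * b' = 1\<^sub>m n"
    using ab unfolding GL_simps(1) by auto
  have "M = a * b * a' * b'"
    using M unfolding inv_GL(1)[OF *(1,2,5)] inv_GL(1)[OF *(3,4,6)] .
  with * pow show ?r unfolding pow_GL[OF *(1)] pow_GL[OF *(3)] by blast
next
  interpret group "GL TYPE('a) n" by (rule group_GL)
  assume ?r
  then obtain a a' b b' where *: "a \<in> carrier_mat n n" "a' \<in> carrier_mat n n" "b \<in> carrier_mat n n"
     "b' \<in> carrier_mat n n" "a * a' = 1\<^sub>m n" "b * b' = 1\<^sub>m n"
     "a ^\<^sub>m k = 1\<^sub>m n" "b ^\<^sub>m k = 1\<^sub>m n" "M = a * b * a' * b'" by blast
  have el: "a \<in> elements_of_order (GL TYPE('a) n) k" "b \<in> elements_of_order (GL TYPE('a) n) k"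
    unfolding elements_of_order_def using *(7,8) inv_GL(2)[OF *(1,2,5)] inv_GL(2)[OF *(3,4,6)]
    by (simp_all only: pow_GL[OF *(1)] pow_GL[OF *(3)] GL_simps(3) mem_Collect_eq)
  have "M = a \<otimes>\<^bsub>GL TYPE('a) n\<^esub> b \<otimes>\<^bsub>GL TYPE('a) n\<^esub> inv\<^bsub>GL TYPE('a) n\<^esub> a \<otimes>\<^bsub>GL TYPE('a) n\<^esub> inv\<^bsub>GL TYPE('a) n\<^esub> b"
    unfolding inv_GL(1)[OF *(1,2,5)] inv_GL(1)[OF *(3,4,6)] GL_simps(2) by (rule *(9))
  then show ?l
    unfolding commutators_of_order_def by (intro UN_I[OF el(1)] UN_I[OF el(2)]) (simp only: singleton_iff)
qed

lemma commutators_of_orderI: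
  fixes a a' b b' :: "'a::field mat"
  assumes "a \<in> carrier_mat n n" "a' \<in> carrier_mat n n" "b \<in> carrier_mat n n"
     "b' \<in> carrier_mat n n" "a * a' = 1\<^sub>m n" "b * b' = 1\<^sub>m n"
     "a ^\<^sub>m k = 1\<^sub>m n" "b ^\<^sub>m k = 1\<^sub>m n" "M = a * b * a' * b'"
  shows "M \<in> commutators_of_order (GL TYPE('a) n) k"
  unfolding commutators_of_order_iff using assms by blast

lemma one_in_commutators_of_order:
  "1\<^sub>m n \<in> commutators_of_order (GL TYPE('a::field) n) k"
proof -
  have "(1\<^sub>m n :: 'a mat) ^\<^sub>m k = 1\<^sub>m n" by (induct k) auto
  then show ?thesis unfolding commutators_of_order_iff
    by (intro exI[of _ "1\<^sub>m n"]) auto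
qed

lemma commutators_of_orderE:
  fixes M :: "'a::field mat"
  assumes "M \<in> commutators_of_order (GL TYPE('a) n) k"
  obtains a a' b b' where "a \<in> carrier_mat n n" "a' \<in> carrier_mat n n" "b \<in> carrier_mat n n"
     "b' \<in> carrier_mat n n" "a * a' = 1\<^sub>m n" "b * b' = 1\<^sub>m n"
     "a ^\<^sub>m k = 1\<^sub>m n" "b ^\<^sub>m k = 1\<^sub>m n" "M = a * b * a' * b'"
  using assms unfolding commutators_of_order_iff by (elim exE conjE)

section \<open>Closure of the commutators under similarity, block sums and multiples of the
  order\<close>

lemma conj_mult:
  fixes A B P Q :: "'a::semiring_1 mat"
  assumes "A \<in> carrier_mat n n" "B \<in> carrier_mat n n" "P \<in> carrier_mat n n" "Q \<in> carrier_mat n n"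
    and "Q * P = 1\<^sub>m n"
  shows "(P * A * Q) * (P * B * Q) = P * (A * B) * Q"
proof -
  have "(P * A * Q) * (P * B * Q) = P * A * (Q * P) * (B * Q)"
    using assms(1-4) by (simp add: assoc_mult_mat[of _ n n _ n _ n])
  then show ?thesis using assms by (simp add: assoc_mult_mat[of _ n n _ n _ n])
qed

text \<open>Conjugation by \<open>P\<close> with inverse \<open>Q\<close> is multiplicative and
  fixes the identity, so it carries \<open>a\<close>, \<open>b\<close> and their inverses to
  matrices with the same relations.\<close>

lemma commutators_of_order_similar:
  fixes A B :: "'a::field mat"
  assumes "similar_mat A B" "B \<in> commutators_of_order (GL TYPE('a) n) k"
  shows "A \<in> commutators_of_order (GL TYPE('a) n) k"
proof -
  obtain a a' b b' where *: "a \<in> carrier_mat n n" "a' \<in> carrier_mat n n" "b \<in> carrier_mat n n"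
     "b' \<in> carrier_mat n n" "a * a' = 1\<^sub>m n" "b * b' = 1\<^sub>m n"
     "a ^\<^sub>m k = 1\<^sub>m n" "b ^\<^sub>m k = 1\<^sub>m n" "B = a * b * a' * b'"
    using assms(2) by (rule commutators_of_orderE)
  then have B: "B \<in> carrier_mat n n" by auto
  obtain P Q where PQ: "similar_mat_wit A B P Q" using assms(1) unfolding similar_mat_def by auto
  then have dA: "n = dim_row A" using similar_mat_witD(5)[OF refl PQ] B by auto
  note D = similar_mat_witD[OF dA PQ]
  let ?c = "\<lambda>X. P * X * Q"
  have pw: "?c X ^\<^sub>m k = 1\<^sub>m n" if "X \<in> carrier_mat n n" "X ^\<^sub>m k = 1\<^sub>m n" for X
  proof -
    have "similar_mat_wit (?c X) X P Q"
      using that D by (intro similar_mat_witI[of _ _ n]) auto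
    from similar_mat_wit_pow_id[OF this, of k] that D show ?thesis by simp
  qed
  have cr: "?c X \<in> carrier_mat n n" if "X \<in> carrier_mat n n" for X
    using that D(6,7) by auto
  have iv: "?c X * ?c Y = 1\<^sub>m n" if "X \<in> carrier_mat n n" "Y \<in> carrier_mat n n" "X * Y = 1\<^sub>m n" for X Y
    using conj_mult[OF that(1,2) D(6,7,2)] that(3) D by simp
  have "?c a * ?c b = ?c (a * b)" "?c (a * b) * ?c a' = ?c (a * b * a')"
    "?c (a * b * a') * ?c b' = ?c (a * b * a' * b')"
    using * by - (rule conj_mult[OF _ _ D(6,7,2)]; (intro mult_carrier_mat)?; assumption)+
  then have A: "A = ?c a * ?c b * ?c a' * ?c b'"
    using D(3) unfolding *(9) by simp
  show ?thesis
    by (rule commutators_of_orderI[OF cr[OF *(1)] cr[OF *(2)] cr[OF *(3)] cr[OF *(4)]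
          iv[OF *(1,2,5)] iv[OF *(3,4,6)] pw[OF *(1,7)] pw[OF *(3,8)] A])
qed

text \<open>The block diagonal embedding of pairs is multiplicative, so the two commutators can be
  formed side by side in the two blocks.\<close>

lemma commutators_of_order_four_block:
  fixes A B :: "'a::field mat"
  assumes "A \<in> commutators_of_order (GL TYPE('a) n) k" "B \<in> commutators_of_order (GL TYPE('a) m) k"
  shows "four_block_mat A (0\<^sub>m n m) (0\<^sub>m m n) B \<in> commutators_of_order (GL TYPE('a) (n + m)) k"
proof -
  obtain a a' b b' where *: "a \<in> carrier_mat n n" "a' \<in> carrier_mat n n" "b \<in> carrier_mat n n"
     "b' \<in> carrier_mat n n" "a * a' = 1\<^sub>m n" "b * b' = 1\<^sub>m n"
     "a ^\<^sub>m k = 1\<^sub>m n" "b ^\<^sub>m k = 1\<^sub>m n" "A = a * b * a' * b'"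
    using assms(1) by (rule commutators_of_orderE)
  obtain c c' d d' where **: "c \<in> carrier_mat m m" "c' \<in> carrier_mat m m" "d \<in> carrier_mat m m"
     "d' \<in> carrier_mat m m" "c * c' = 1\<^sub>m m" "d * d' = 1\<^sub>m m"
     "c ^\<^sub>m k = 1\<^sub>m m" "d ^\<^sub>m k = 1\<^sub>m m" "B = c * d * c' * d'"
    using assms(2) by (rule commutators_of_orderE)
  let ?F = "\<lambda>X Y. four_block_mat X (0\<^sub>m n m) (0\<^sub>m m n) Y"
  have mult: "?F X Y * ?F X' Y' = ?F (X * X') (Y * Y')"
    if "X \<in> carrier_mat n n" "X' \<in> carrier_mat n n" "Y \<in> carrier_mat m m" "Y' \<in> carrier_mat m m"
    for X X' Y Y' :: "'a mat"
    using that by (subst mult_four_block_mat[where ?nr1.0=n and ?nr2.0=m and ?n1.0=n and ?n2.0=m and ?nc1.0=n and ?nc2.0=m]) auto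
  have "?F a c * ?F b d = ?F (a * b) (c * d)" "?F (a * b) (c * d) * ?F a' c' = ?F (a * b * a') (c * d * c')"
    "?F (a * b * a') (c * d * c') * ?F b' d' = ?F (a * b * a' * b') (c * d * c' * d')"
    using * ** by - (rule mult; (intro mult_carrier_mat)?; assumption)+
  then have "?F A B = ?F a c * ?F b d * ?F a' c' * ?F b' d'"
    by (simp only: *(9) **(9))
  then show ?thesis
    by (intro commutators_of_orderI[of "?F a c" _ "?F a' c'" "?F b d" "?F b' d'"])
      (simp_all add: mult pow_four_block_mat * **)
qed

text \<open>Serves to pass from involutions to elements of any even order \<open>k\<close>.\<close>

lemma commutators_of_order_dvd:
  assumes "M \<in> commutators_of_order (GL TYPE('a::field) n) j" "j dvd k"
  shows "M \<in> commutators_of_order (GL TYPE('a) n) k"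
proof -
  have "a ^\<^sub>m k = 1\<^sub>m n" if a: "a \<in> carrier_mat n n" "a ^\<^sub>m j = 1\<^sub>m n" for a :: "'a mat"
  proof -
    obtain i where k: "k = j * i" using assms(2) by (auto elim: dvdE)
    interpret ring "ring_mat TYPE('a) n ()" by (rule ring_mat)
    have "a [^]\<^bsub>ring_mat TYPE('a) n ()\<^esub> (j * i) = (a [^]\<^bsub>ring_mat TYPE('a) n ()\<^esub> j) [^]\<^bsub>ring_mat TYPE('a) n ()\<^esub> i"
      using nat_pow_pow[of a j i] a by (simp add: ring_mat_simps)
    moreover have "(1\<^sub>m n :: 'a mat) ^\<^sub>m i = 1\<^sub>m n" by (induct i) auto
    ultimately show ?thesis using a pow_mat_ring_pow[of a n _ "()"] pow_mat_ring_pow[of "1\<^sub>m n :: 'a mat" n i "()"]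
      by (simp add: k)
  qed
  with assms(1) show ?thesis by (elim commutators_of_orderE) (rule commutators_of_orderI)
qed

section \<open>Diagonal matrices\<close>


lemma mk_diagonal_append:
  "mk_diagonal (as @ bs) = four_block_mat (mk_diagonal as) (0\<^sub>m (length as) (length bs))
    (0\<^sub>m (length bs) (length as)) (mk_diagonal bs)"
  by (simp add: mk_diagonal_def diag_block_mat_append Let_def mk_diagonal_dim[unfolded mk_diagonal_def])

lemma mk_diagonal_Nil: "mk_diagonal [] = 0\<^sub>m 0 0"
  by (simp add: mk_diagonal_def)

lemma mk_diagonal_single: "mk_diagonal [a] = mat 1 1 (\<lambda>_. a)"
  by (intro eq_matI) (auto simp: mk_diagonal_def)

lemma mk_diagonal_Cons:
  "mk_diagonal (a # as) = four_block_mat (mat 1 1 (\<lambda>_. a)) (0\<^sub>m 1 (length as))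
    (0\<^sub>m (length as) 1) (mk_diagonal as)"
  using mk_diagonal_append[of "[a]" as] by (simp add: mk_diagonal_single)

lemma mk_diagonal_eq:
  "mk_diagonal as = mat (length as) (length as) (\<lambda>(i, j). if i = j then as ! i else 0)"
proof (induct as)
  case (Cons a as)
  show ?case unfolding mk_diagonal_Cons Cons
    by (intro eq_matI) (auto simp: nth_Cons')
qed (auto simp: mk_diagonal_Nil)

lemma mk_diagonal_carrier [simp]: "mk_diagonal as \<in> carrier_mat (length as) (length as)"
  by (simp add: mk_diagonal_eq)

lemma transpose_mk_diagonal: "transpose_mat (mk_diagonal as) = mk_diagonal as"
  by (intro eq_matI) (auto simp: mk_diagonal_eq)

section \<open>Block triangular matrices: diagonalisation and factorisation\<close>

lemma similar_mat_transpose: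
  fixes A B :: "'a::comm_ring_1 mat"
  assumes "similar_mat A B"
  shows "similar_mat (transpose_mat A) (transpose_mat B)"
proof -
  obtain n P Q where c: "{A, B, P, Q} \<subseteq> carrier_mat n n" and PQ: "P * Q = 1\<^sub>m n" "Q * P = 1\<^sub>m n"
    and A: "A = P * B * Q"
    using similar_matD[OF assms] by blast
  have "transpose_mat A = transpose_mat Q * transpose_mat B * transpose_mat P"
    using c unfolding A by (auto simp: transpose_mult[of _ n n _ n] intro!: assoc_mult_mat[symmetric, of _ n n _ n _ n])
  then show ?thesis using c PQ
    by (intro similar_matI[of _ _ "transpose_mat Q" "transpose_mat P" n])
      (auto simp: transpose_mult[symmetric, of _ n n _ n] transpose_one)
qed

text \<open>Diagonalising \<open>U\<close> first only replaces the row \<open>y\<close> by some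
  other row \<open>z\<close>. A unipotent conjugation then removes \<open>z\<close>, because
  \<open>b\<close> differs from every eigenvalue of \<open>U\<close>.\<close>

lemma similar_mk_diagonal_upper_block:
  fixes U :: "'a::field mat"
  assumes U: "similar_mat U (mk_diagonal ts)" "U \<in> carrier_mat m m" "m = length ts"
    and b: "b \<notin> set ts" and y: "y \<in> carrier_mat 1 m"
  shows "similar_mat (four_block_mat (mat 1 1 (\<lambda>_. b)) y (0\<^sub>m m 1) U) (mk_diagonal (b # ts))"
proof -
  let ?b = "mat 1 1 (\<lambda>_. b) :: 'a mat" and ?D = "mk_diagonal ts"
  have bc: "?b \<in> carrier_mat 1 1" and D: "?D \<in> carrier_mat m m"
    using U(3) by auto
  obtain z where z: "z \<in> carrier_mat 1 m"
    and s: "similar_mat (four_block_mat ?b y (0\<^sub>m m 1) U) (four_block_mat ?b z (0\<^sub>m m 1) ?D)"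
    using similar_mat_four_block_0_ex[OF similar_mat_refl[OF bc] U(1) y bc U(2)] by blast
  \<comment> \<open>This row solves \<open>w * ?D - b * w = z\<close>, entry by entry;
    \<open>w'\<close> is its negative and gives the inverse conjugating matrix
    \<open>?Q\<close>.\<close>
  define w where "w = mat 1 m (\<lambda>(i, j). z $$ (0, j) / (ts ! j - b))"
  define w' where "w' = mat 1 m (\<lambda>(i, j). - (z $$ (0, j) / (ts ! j - b)))"
  have w: "w \<in> carrier_mat 1 m" "w' \<in> carrier_mat 1 m" by (simp_all add: w_def w'_def)
  have ww: "w + w' = 0\<^sub>m 1 m" "w' + w = 0\<^sub>m 1 m" by (auto simp: w_def w'_def)
  let ?P = "four_block_mat (1\<^sub>m 1) w (0\<^sub>m m 1) (1\<^sub>m m)"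
  let ?Q = "four_block_mat (1\<^sub>m 1) w' (0\<^sub>m m 1) (1\<^sub>m m)"
  let ?E = "four_block_mat ?b (0\<^sub>m 1 m) (0\<^sub>m m 1) ?D"
  note mult = mult_four_block_mat[of _ 1 1 _ m _ m _ _ 1 _ m]
  have PQ: "?P * ?Q = 1\<^sub>m (1 + m)" "?Q * ?P = 1\<^sub>m (1 + m)"
    using w ww by (auto simp: mult)
  have PE: "?P * ?E = four_block_mat ?b (w * ?D) (0\<^sub>m m 1) ?D"
    using w bc D by (auto simp: mult)
  have "four_block_mat ?b (w * ?D) (0\<^sub>m m 1) ?D * ?Q = four_block_mat ?b (?b * w' + w * ?D) (0\<^sub>m m 1) ?D"
    using w bc D by (subst mult[of _ _ _ ?D]) auto
  also have "?b * w' + w * ?D = z"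
  proof (rule eq_matI)
    fix i j assume "i < dim_row z" "j < dim_col z"
    then have i: "i = 0" and j: "j < m" using z by auto
    have "(w * ?D) $$ (0, j) = (\<Sum>l = 0..<m. w $$ (0, l) * (if l = j then ts ! l else 0))"
      using j w U(3) by (simp add: scalar_prod_def mk_diagonal_eq)
    also have "\<dots> = w $$ (0, j) * ts ! j"
      using j by (simp add: if_distrib cong: if_cong)
    finally have 1: "(w * ?D) $$ (0, j) = w $$ (0, j) * ts ! j" .
    have 2: "(?b * w') $$ (0, j) = - b * w $$ (0, j)"
      using j by (simp add: scalar_prod_def w_def w'_def)
    have "ts ! j - b \<noteq> 0" using b j U(3) by (auto simp: in_set_conv_nth)
    then have "w $$ (0, j) * (ts ! j - b) = z $$ (0, j)"
      using j by (simp add: w_def)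
    then have "- b * w $$ (0, j) + w $$ (0, j) * ts ! j = z $$ (0, j)"
      by (simp add: algebra_simps)
    then show "(?b * w' + w * ?D) $$ (i, j) = z $$ (i, j)"
      using 1 2 i j w D by simp
  qed (use z w D in auto)
  finally have "four_block_mat ?b z (0\<^sub>m m 1) ?D = ?P * ?E * ?Q" using PE by simp
  then have "similar_mat (four_block_mat ?b z (0\<^sub>m m 1) ?D) ?E"
    using PQ w D bc z by (intro similar_matI[of _ _ ?P ?Q "1 + m"]) auto
  from similar_mat_trans[OF s this] show ?thesis unfolding mk_diagonal_Cons U(3) .
qed

text \<open>Transposition turns this into the upper triangular case, since diagonal matrices are
  symmetric.\<close>

lemma similar_mk_diagonal_lower_block:
  fixes L :: "'a::field mat"
  assumes L: "similar_mat L (mk_diagonal ts)" "L \<in> carrier_mat m m" "m = length ts"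
    and b: "b \<notin> set ts" and x: "x \<in> carrier_mat m 1"
  shows "similar_mat (four_block_mat (mat 1 1 (\<lambda>_. b)) (0\<^sub>m 1 m) x L) (mk_diagonal (b # ts))"
proof -
  have "similar_mat (transpose_mat L) (mk_diagonal ts)"
    using similar_mat_transpose[OF L(1)] by (simp add: transpose_mk_diagonal)
  from similar_mk_diagonal_upper_block[OF this _ L(3) b, of "transpose_mat x"]
  have "similar_mat (four_block_mat (mat 1 1 (\<lambda>_. b)) (transpose_mat x) (0\<^sub>m m 1) (transpose_mat L))
     (mk_diagonal (b # ts))" using L x by simp
  from similar_mat_transpose[OF this]
  have "similar_mat (four_block_mat (transpose_mat (mat 1 1 (\<lambda>_. b))) (0\<^sub>m 1 m) x L) (mk_diagonal (b # ts))"
    using L x by (subst (asm) transpose_four_block_mat[of _ 1 1 _ m _ m])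
      (auto simp: transpose_mk_diagonal)
  moreover have "transpose_mat (mat 1 1 (\<lambda>_. b)) = mat 1 1 (\<lambda>_. b)" by auto
  ultimately show ?thesis by simp
qed

text \<open>Block LU factorisation: the pivot \<open>b * c\<close> is shared between the corners of
  the two triangular factors, and the Schur complement of the pivot is shared as
  \<open>X * Y\<close>. A factorisation of the Schur complement thus lifts to the whole
  matrix.\<close>

lemma four_block_factor:
  fixes R :: "'a::field mat"
  assumes b: "b \<noteq> 0" and x: "x \<in> carrier_mat m 1" and y: "y \<in> carrier_mat 1 m"
    and X: "X \<in> carrier_mat m m" and Y: "Y \<in> carrier_mat m m" and R: "R \<in> carrier_mat m m"
    and S: "R - inverse (b * c) \<cdot>\<^sub>m (x * y) = X * Y" and c: "c \<noteq> 0"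
  shows "four_block_mat (mat 1 1 (\<lambda>_. b * c)) y x R =
    four_block_mat (mat 1 1 (\<lambda>_. b)) (0\<^sub>m 1 m) (inverse c \<cdot>\<^sub>m x) X *
    four_block_mat (mat 1 1 (\<lambda>_. c)) (inverse b \<cdot>\<^sub>m y) (0\<^sub>m m 1) Y"
proof -
  have "mat 1 1 (\<lambda>_. b) * mat 1 1 (\<lambda>_. c) + 0\<^sub>m 1 m * 0\<^sub>m m 1 = mat 1 1 (\<lambda>_. b * c)"
    by (rule eq_matI) (auto simp: scalar_prod_def)
  moreover have "mat 1 1 (\<lambda>_. b) * (inverse b \<cdot>\<^sub>m y) + 0\<^sub>m 1 m * Y = y"
    using b y Y by (intro eq_matI) (auto simp: scalar_prod_def)
  moreover have "(inverse c \<cdot>\<^sub>m x) * mat 1 1 (\<lambda>_. c) + X * 0\<^sub>m m 1 = x"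
    using c x X by (intro eq_matI) (auto simp: scalar_prod_def)
  moreover have "(inverse c \<cdot>\<^sub>m x) * (inverse b \<cdot>\<^sub>m y) + X * Y = R"
    unfolding S[symmetric] using x y R b c
    by (intro eq_matI) (auto simp: scalar_prod_def field_simps)
  ultimately show ?thesis
    using x y X Y
    by (subst mult_four_block_mat[of _ 1 1 _ m _ m _ _ 1 _ m]) auto
qed

section \<open>Sourour's factorisation\<close>


text \<open>If \<open>A\<close> is not diagonal, it serves itself. A diagonal nonscalar matrix has
  two different diagonal entries, and conjugation by an elementary matrix puts their difference off
  the diagonal.\<close>

lemma nonscalar_similar_offdiag:
  fixes A :: "'a::field mat"
  assumes A: "A \<in> carrier_mat n n" and ns: "\<And>c. A \<noteq> c \<cdot>\<^sub>m 1\<^sub>m n"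
  obtains B i j where "B \<in> carrier_mat n n" "similar_mat A B" "i < n" "j < n" "i \<noteq> j" "B $$ (i, j) \<noteq> 0"
proof (cases "\<exists>i j. i < n \<and> j < n \<and> i \<noteq> j \<and> A $$ (i, j) \<noteq> 0")
  case True
  then obtain i j where "i < n" "j < n" "i \<noteq> j" "A $$ (i, j) \<noteq> 0" by blast
  then show ?thesis by (rule that[OF A similar_mat_refl[OF A]])
next
  case False
  have "n > 0"
  proof (rule gr0I)
    assume "n = 0"
    \<comment> \<open>The empty matrix counts as scalar, so \<open>n = 0\<close> is excluded by the
      hypothesis.\<close>
    then have "A = 0 \<cdot>\<^sub>m 1\<^sub>m n" using A by (intro eq_matI) auto
    with ns[of 0] show False by (rule notE)
  qed
  have "\<exists>i<n. A $$ (i, i) \<noteq> A $$ (0, 0)"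
  proof (rule ccontr)
    assume "\<not> ?thesis"
    then have d: "\<And>i. i < n \<Longrightarrow> A $$ (i, i) = A $$ (0, 0)" by blast
    have z: "\<And>i j. i < n \<Longrightarrow> j < n \<Longrightarrow> i \<noteq> j \<Longrightarrow> A $$ (i, j) = 0" using False by blast
    define a where "a = A $$ (0, 0)"
    have "A $$ (i, j) = (a \<cdot>\<^sub>m 1\<^sub>m n) $$ (i, j)" if "i < n" "j < n" for i j
      unfolding a_def using that z[of i j] d[of i] by (cases "i = j") auto
    then have "A = A $$ (0, 0) \<cdot>\<^sub>m 1\<^sub>m n"
      unfolding a_def[symmetric] using A by (intro eq_matI) auto
    with ns[of "A $$ (0, 0)"] show False by (rule notE)
  qed
  then obtain i where i: "i < n" "A $$ (i, i) \<noteq> A $$ (0, 0)" by blast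
  have i0: "i \<noteq> 0" using i(2) by (rule contrapos_nn) simp
  have z: "A $$ (0, i) = 0" "A $$ (i, 0) = 0"
    using False i(1) i0 \<open>n > 0\<close> by blast+
  \<comment> \<open>The conjugation adds column \<open>i\<close> to column 0 and subtracts row 0
    from row \<open>i\<close>.\<close>
  have "add_col_sub_row 1 i 0 A $$ (i, 0) = A $$ (i, i) - A $$ (0, 0)"
    using z i(1) i0 A \<open>n > 0\<close> by simp
  then have nz: "add_col_sub_row 1 i 0 A $$ (i, 0) \<noteq> 0" using i by simp
  have "add_col_sub_row 1 i 0 A \<in> carrier_mat n n" using A by simp
  from that[OF this similar_mat_sym[OF add_col_sub_row_similar[OF A i(1) \<open>n > 0\<close> i0]] i(1) \<open>n > 0\<close> i0 nz]
  show ?thesis .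
qed

text \<open>Once column 0 has a nonzero entry below the corner, an elementary conjugation can give
  the corner any value \<open>a\<close> while keeping that entry. The resulting
  \<open>x \<noteq> 0\<close> is needed later to make the Schur complement nonscalar.\<close>

lemma nonscalar_similar_pivot:
  fixes A :: "'a::field mat"
  assumes A: "A \<in> carrier_mat (Suc m) (Suc m)" and ns: "\<And>c. A \<noteq> c \<cdot>\<^sub>m 1\<^sub>m (Suc m)"
  obtains x y R where "x \<in> carrier_mat m 1" "y \<in> carrier_mat 1 m" "R \<in> carrier_mat m m"
    "x \<noteq> 0\<^sub>m m 1" "similar_mat A (four_block_mat (mat 1 1 (\<lambda>_. a)) y x R)"
proof -
  let ?n = "Suc m"
  obtain B i j where B: "B \<in> carrier_mat ?n ?n" "similar_mat A B"
    and ij: "i < ?n" "j < ?n" "i \<noteq> j" "B $$ (i, j) \<noteq> 0"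
    by (rule nonscalar_similar_offdiag[OF A ns])
  define C where "C = swap_cols_rows 0 j B"
  \<comment> \<open>Row of the nonzero entry after the swap: row \<open>i\<close> is unaffected
    unless \<open>i = 0\<close>, in which case it becomes row \<open>j\<close>.\<close>
  define l where "l = (if i = 0 then j else i)"
  have C: "C \<in> carrier_mat ?n ?n" "similar_mat C B"
    using B ij swap_cols_rows_similar[of B ?n 0 j] by (auto simp: C_def)
  have l: "l < ?n" "l \<noteq> 0" "C $$ (l, 0) \<noteq> 0"
    using ij B unfolding C_def l_def by auto
  \<comment> \<open>Conjugation subtracts \<open>c\<close> times row \<open>l\<close> from row 0, so
    this value turns the corner into \<open>a\<close>; the column operation only alters column
    \<open>l\<close>, not column 0.\<close>
  define c where "c = (C $$ (0, 0) - a) / C $$ (l, 0)"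
  define D where "D = add_col_sub_row c 0 l C"
  have D: "D \<in> carrier_mat ?n ?n" "similar_mat D C"
    using C l add_col_sub_row_similar[of C ?n 0 l c] by (auto simp: D_def)
  have D00: "D $$ (0, 0) = a" "D $$ (l, 0) \<noteq> 0"
    using C l unfolding D_def by (auto simp: c_def)
  obtain X y x R where s: "split_block D 1 1 = (X, y, x, R)" by (metis prod_cases4)
  note sb = split_block[OF s, of m m]
  have X: "X = mat 1 1 (\<lambda>_. a)"
    using s D00(1) unfolding split_block_def Let_def by auto
  have "x $$ (l - 1, 0) = D $$ (l, 0)"
    using s D l unfolding split_block_def Let_def by auto
  then have "x \<noteq> 0\<^sub>m m 1" using D00(2) l by auto
  moreover have "similar_mat A D"
    using similar_mat_trans[OF B(2) similar_mat_sym[OF similar_mat_trans[OF D(2) C(2)]]] .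
  moreover have "D = four_block_mat (mat 1 1 (\<lambda>_. a)) y x R" "x \<in> carrier_mat m 1"
    "y \<in> carrier_mat 1 m" "R \<in> carrier_mat m m"
    using sb D X by simp_all
  ultimately show ?thesis by (intro that[of x y R]) simp_all
qed

section \<open>The Schur complement of the pivot\<close>

lemma det_four_block_schur:
  fixes R :: "'a::field mat"
  assumes a: "a \<noteq> 0" and x: "x \<in> carrier_mat m 1" and y: "y \<in> carrier_mat 1 m"
    and R: "R \<in> carrier_mat m m"
  shows "det (four_block_mat (mat 1 1 (\<lambda>_. a)) y x R) = a * det (R - inverse a \<cdot>\<^sub>m (x * y))"
proof -
  let ?S = "R - inverse a \<cdot>\<^sub>m (x * y)"
  have S: "?S \<in> carrier_mat m m" using x y R by (intro minus_carrier_mat) auto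
  \<comment> \<open>Block LU factorisation with a unipotent lower factor: the pivot is split as
    \<open>1 * a\<close> and the Schur complement as \<open>1\<^sub>m m * ?S\<close>.\<close>
  have "four_block_mat (mat 1 1 (\<lambda>_. 1 * a)) y x R =
     four_block_mat (mat 1 1 (\<lambda>_. 1)) (0\<^sub>m 1 m) (inverse a \<cdot>\<^sub>m x) (1\<^sub>m m) *
     four_block_mat (mat 1 1 (\<lambda>_. a)) (inverse 1 \<cdot>\<^sub>m y) (0\<^sub>m m 1) ?S"
    using a x y R S by (intro four_block_factor) auto
  moreover have "inverse 1 \<cdot>\<^sub>m y = y" by (intro eq_matI) auto
  ultimately have "det (four_block_mat (mat 1 1 (\<lambda>_. a)) y x R) =
     det (four_block_mat (mat 1 1 (\<lambda>_. 1)) (0\<^sub>m 1 m) (inverse a \<cdot>\<^sub>m x) (1\<^sub>m m)) *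
     det (four_block_mat (mat 1 1 (\<lambda>_. a)) y (0\<^sub>m m 1) ?S)"
    using S by (subst det_mult[symmetric, of _ "1 + m"]) (auto intro!: four_block_carrier_mat[of _ 1 1 _ m m, simplified])
  also have "\<dots> = (det (mat 1 1 (\<lambda>_. 1) :: 'a mat) * det (1\<^sub>m m)) * (det (mat 1 1 (\<lambda>_. a)) * det ?S)"
    using x y S by (subst det_four_block_mat_upper_right_zero[of _ 1 _ m] det_four_block_mat_lower_left_zero[of _ 1 _ m]; simp)+
  finally show ?thesis by (simp add: det_single)
qed

text \<open>If the Schur complement is \<open>c\<close> times the identity, conjugation by the
  unipotent matrix with a row \<open>z\<close> such that \<open>z * x = 0\<close> keeps the pivot
  and \<open>x\<close>, but subtracts \<open>c / a\<close> times \<open>x * z\<close> from the Schur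
  complement. This rank one term makes it nonscalar; size at least 2 leaves room for such a nonzero
  \<open>z\<close>.\<close>

lemma nonscalar_schur_complement:
  fixes R :: "'a::field mat"
  assumes a: "a \<noteq> 0" and x: "x \<in> carrier_mat m 1" and y: "y \<in> carrier_mat 1 m"
    and R: "R \<in> carrier_mat m m" and x0: "x \<noteq> 0\<^sub>m m 1" and m: "m \<ge> 2"
    and det: "det (four_block_mat (mat 1 1 (\<lambda>_. a)) y x R) \<noteq> 0"
  obtains y' R' where "y' \<in> carrier_mat 1 m" "R' \<in> carrier_mat m m"
    "similar_mat (four_block_mat (mat 1 1 (\<lambda>_. a)) y x R) (four_block_mat (mat 1 1 (\<lambda>_. a)) y' x R')"
    "\<And>c. R' - inverse a \<cdot>\<^sub>m (x * y') \<noteq> c \<cdot>\<^sub>m 1\<^sub>m m"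
proof (cases "\<forall>c. R - inverse a \<cdot>\<^sub>m (x * y) \<noteq> c \<cdot>\<^sub>m 1\<^sub>m m")
  case True
  have "four_block_mat (mat 1 1 (\<lambda>_. a)) y x R \<in> carrier_mat (1 + m) (1 + m)"
    using R by (intro four_block_carrier_mat) auto
  then show ?thesis using that[OF y R] similar_mat_refl True by blast
next
  case False
  let ?A = "mat 1 1 (\<lambda>_. a)"
  obtain c where c: "R - inverse a \<cdot>\<^sub>m (x * y) = c \<cdot>\<^sub>m 1\<^sub>m m" using False by blast
  \<comment> \<open>The determinant is \<open>a\<close> times the \<open>m\<close>-th power of
    \<open>c\<close>.\<close>
  have c0: "c \<noteq> 0"
    using det m unfolding det_four_block_schur[OF a x y R] c by (auto simp: det_smult)
  have xy: "(x * u) $$ (i, j) = x $$ (i, 0) * u $$ (0, j)"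
    if "u \<in> carrier_mat 1 m" "i < m" "j < m" for u :: "'a mat" and i j
    using that x by (auto simp: scalar_prod_def)
  have Rij: "R $$ (i, j) = (if i = j then c else 0) + x $$ (i, 0) * y $$ (0, j) / a"
    if "i < m" "j < m" for i j
  proof -
    have "(R - inverse a \<cdot>\<^sub>m (x * y)) $$ (i, j) = (c \<cdot>\<^sub>m 1\<^sub>m m) $$ (i, j)" by (simp only: c)
    then show ?thesis using that x y R xy[OF y that] by (auto simp: field_simps)
  qed
  have "\<exists>i<m. x $$ (i, 0) \<noteq> 0"
  proof (rule ccontr)
    assume "\<not> ?thesis"
    then have "x = 0\<^sub>m m 1" using x by (intro eq_matI) auto
    with x0 show False by simp
  qed
  then obtain i where i: "i < m" "x $$ (i, 0) \<noteq> 0" by blast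
  obtain j where j: "j < m" "j \<noteq> i" using m that[of 0] that[of 1] by (cases "i = 0") auto
  \<comment> \<open>Orthogonal to \<open>x\<close> by cancellation of the two entries, and nonzero
    at \<open>j\<close> because \<open>x\<close> is nonzero at \<open>i\<close>.\<close>
  define z where "z = mat 1 m (\<lambda>(_, l). if l = j then x $$ (i, 0) else if l = i then - x $$ (j, 0) else 0)"
  define z' where "z' = mat 1 m (\<lambda>(_, l). - z $$ (0, l))"
  have z: "z \<in> carrier_mat 1 m" "z' \<in> carrier_mat 1 m" by (simp_all add: z_def z'_def)
  have zz: "z + z' = 0\<^sub>m 1 m" "z' + z = 0\<^sub>m 1 m" by (auto simp: z_def z'_def)
  have zx0: "(\<Sum>l = 0..<m. z $$ (0, l) * x $$ (l, 0)) = 0"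
  proof -
    have "(\<Sum>l = 0..<m. z $$ (0, l) * x $$ (l, 0)) =
      (\<Sum>l = 0..<m. (if l = j then x $$ (i, 0) * x $$ (j, 0) else 0) +
                   (if l = i then - x $$ (j, 0) * x $$ (i, 0) else 0))"
      using j by (intro sum.cong) (auto simp: z_def)
    then show ?thesis using i j by (simp add: sum.distrib)
  qed
  then have zx: "z * x = 0\<^sub>m 1 1"
    using z x by (intro eq_matI) (auto simp: scalar_prod_def)
  \<comment> \<open>\<open>R\<close> is \<open>c\<close> times the identity plus a multiple of
    \<open>x * y\<close>, and \<open>z\<close> annihilates the second term.\<close>
  have zR: "z * R = c \<cdot>\<^sub>m z"
  proof (rule eq_matI)
    fix k l assume "k < dim_row (c \<cdot>\<^sub>m z)" "l < dim_col (c \<cdot>\<^sub>m z)"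
    then have kl: "k = 0" "l < m" using z by auto
    have "(z * R) $$ (0, l) = (\<Sum>h = 0..<m. z $$ (0, h) * R $$ (h, l))"
      using kl z R by (auto simp: scalar_prod_def)
    also have "\<dots> = (\<Sum>h = 0..<m. (if h = l then c * z $$ (0, l) else 0) + z $$ (0, h) * x $$ (h, 0) * (y $$ (0, l) / a))"
      using kl by (intro sum.cong) (auto simp: Rij algebra_simps)
    also have "\<dots> = c * z $$ (0, l) + (\<Sum>h = 0..<m. z $$ (0, h) * x $$ (h, 0)) * (y $$ (0, l) / a)"
      using kl by (simp add: sum.distrib sum_distrib_right sum_divide_distrib)
    also have "\<dots> = c * z $$ (0, l)" by (simp add: zx0)
    finally show "(z * R) $$ (k, l) = (c \<cdot>\<^sub>m z) $$ (k, l)" using kl z by auto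
  qed (use z R in auto)
  define y' where "y' = ?A * z' + (y + z * R)"
  define R' where "R' = x * z' + R"
  have c': "y' \<in> carrier_mat 1 m" "R' \<in> carrier_mat m m"
    using x y z R by (auto simp: y'_def R'_def intro!: add_carrier_mat mult_carrier_mat[of _ _ 1])
  let ?P = "four_block_mat (1\<^sub>m 1) z (0\<^sub>m m 1) (1\<^sub>m m)"
  let ?Q = "four_block_mat (1\<^sub>m 1) z' (0\<^sub>m m 1) (1\<^sub>m m)"
  let ?M = "four_block_mat ?A y x R"
  note mult = mult_four_block_mat[of _ 1 1 _ m _ m _ _ 1 _ m]
  have PQ: "?P * ?Q = 1\<^sub>m (1 + m)" "?Q * ?P = 1\<^sub>m (1 + m)"
    using z zz by (auto simp: mult)
  have "?P * ?M = four_block_mat ?A (y + z * R) x R"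
    using z x y R zx by (subst mult) (auto simp: right_add_zero_mat[of _ 1 1])
  moreover have "four_block_mat ?A (y + z * R) x R * ?Q = four_block_mat ?A y' x R'"
    using z x y R by (subst mult) (auto simp: y'_def R'_def)
  ultimately have "four_block_mat ?A y' x R' = ?P * ?M * ?Q" by simp
  then have "similar_mat (four_block_mat ?A y' x R') ?M"
    using PQ z x y R c' by (intro similar_matI[of _ _ ?P ?Q "1 + m"]) auto
  then have sim: "similar_mat ?M (four_block_mat ?A y' x R')" by (rule similar_mat_sym)
  have y'j: "y' $$ (0, j) = y $$ (0, j) + c * z $$ (0, j) - a * z $$ (0, j)"
    using y z j unfolding y'_def zR by (simp add: scalar_prod_def z'_def)
  have R'ij: "R' $$ (i, j) = x $$ (i, 0) * y $$ (0, j) / a - x $$ (i, 0) * z $$ (0, j)"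
    using x R z i j xy[OF z(2)] Rij[of i j] unfolding R'_def by (simp add: z'_def)
  \<comment> \<open>The entry at \<open>(i, j)\<close> comes only from the rank one term; the choice
    of \<open>z\<close> at \<open>j\<close> makes it a nonzero multiple of the square of the entry
    of \<open>x\<close> at \<open>i\<close>.\<close>
  have "(R' - inverse a \<cdot>\<^sub>m (x * y')) $$ (i, j) = - c / a * (x $$ (i, 0) * x $$ (i, 0))"
  proof -
    have zj: "z $$ (0, j) = x $$ (i, 0)" using j by (simp add: z_def)
    have "(R' - inverse a \<cdot>\<^sub>m (x * y')) $$ (i, j) = R' $$ (i, j) - inverse a * (x $$ (i, 0) * y' $$ (0, j))"
      using c' x i j xy[OF c'(1), of i j] by simp
    then show ?thesis unfolding R'ij y'j zj using a by (simp add: field_simps)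
  qed
  then have nz: "(R' - inverse a \<cdot>\<^sub>m (x * y')) $$ (i, j) \<noteq> 0"
    using i a c0 by simp
  have "R' - inverse a \<cdot>\<^sub>m (x * y') \<noteq> d \<cdot>\<^sub>m 1\<^sub>m m" for d
    using nz i j by auto
  then show ?thesis by (rule that[OF c' sim])
qed


text \<open>Sourour allows different prescribed eigenvalues for the two factors; equal ones suffice here.\<close>

lemma nonscalar_factor_similar_mk_diagonal:
  fixes A :: "'a::field mat"
  assumes "distinct ts" "0 \<notin> set ts" "ts \<noteq> []" "A \<in> carrier_mat (length ts) (length ts)"
    and "det A = prod_list ts * prod_list ts"
    and "length ts = 1 \<or> (\<forall>c. A \<noteq> c \<cdot>\<^sub>m 1\<^sub>m (length ts))"
  shows "\<exists>X Y. X \<in> carrier_mat (length ts) (length ts) \<and> Y \<in> carrier_mat (length ts) (length ts) \<and>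
    A = X * Y \<and> similar_mat X (mk_diagonal ts) \<and> similar_mat Y (mk_diagonal ts)"
  using assms
proof (induct ts arbitrary: A)
  case (Cons b ts)
  let ?n = "Suc (length ts)" and ?m = "length ts"
  have A: "A \<in> carrier_mat ?n ?n" using Cons.prems by simp
  have b: "b \<noteq> 0" "b \<notin> set ts" using Cons.prems by auto
  show ?case
  proof (cases "ts = []")
    case True
    have "det A = A $$ (0, 0)" using det_single[of A] A True by simp
    then have "A = mk_diagonal [b] * mk_diagonal [b]"
      using Cons.prems(5) A True
      by (intro eq_matI) (auto simp: mk_diagonal_single scalar_prod_def)
    moreover have "mk_diagonal [b] \<in> carrier_mat 1 1" by (simp add: mk_diagonal_single)
    ultimately show ?thesis using similar_mat_refl[of "mk_diagonal [b]" 1] True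
      by (intro exI[of _ "mk_diagonal [b]"]) auto
  next
    case ne: False
    then have ns: "\<And>c. A \<noteq> c \<cdot>\<^sub>m 1\<^sub>m ?n" using Cons.prems(6) by auto
    \<comment> \<open>Both factors are to have the eigenvalue \<open>b\<close>, so the pivot is
      prescribed as \<open>b * b\<close>.\<close>
    let ?a = "b * b" and ?b = "mat 1 1 (\<lambda>_. b)"
    have a: "?a \<noteq> 0" using b by simp
    obtain x y R where xyR: "x \<in> carrier_mat ?m 1" "y \<in> carrier_mat 1 ?m" "R \<in> carrier_mat ?m ?m"
      "x \<noteq> 0\<^sub>m ?m 1" and sim: "similar_mat A (four_block_mat (mat 1 1 (\<lambda>_. ?a)) y x R)"
      by (rule nonscalar_similar_pivot[OF A ns])
    have pr: "prod_list ts \<noteq> 0" using Cons.prems(2) by (auto simp: prod_list_zero_iff)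
    have "det A \<noteq> 0"
      using pr b by (simp add: Cons.prems(5))
    then have "det (four_block_mat (mat 1 1 (\<lambda>_. ?a)) y x R) \<noteq> 0"
      by (simp only: det_similar[OF sim] not_False_eq_True)
    note schur = nonscalar_schur_complement[OF a xyR(1-4) _ this]
    \<comment> \<open>A Schur complement of size one is always scalar; the first alternative of the
      hypothesis admits it to the induction.\<close>
    obtain y' R' where yR: "y' \<in> carrier_mat 1 ?m" "R' \<in> carrier_mat ?m ?m"
      and sim': "similar_mat A (four_block_mat (mat 1 1 (\<lambda>_. ?a)) y' x R')"
      and ns': "?m = 1 \<or> (\<forall>c. R' - inverse ?a \<cdot>\<^sub>m (x * y') \<noteq> c \<cdot>\<^sub>m 1\<^sub>m ?m)"
    proof (cases "?m = 1")
      case True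
      show ?thesis by (rule that[OF xyR(2,3) sim disjI1[OF True]])
    next
      case False
      then have m: "?m \<ge> 2" using ne by (cases ts) (auto simp: Suc_le_eq)
      show ?thesis
        by (rule schur[OF m]) (rule that[OF _ _ similar_mat_trans[OF sim] disjI2], auto)
    qed
    let ?S = "R' - inverse ?a \<cdot>\<^sub>m (x * y')"
    have S: "?S \<in> carrier_mat ?m ?m" using xyR yR by (intro minus_carrier_mat) auto
    \<comment> \<open>Cancelling the pivot leaves the determinant that the induction hypothesis asks
      for.\<close>
    have "?a * det ?S = ?a * (prod_list ts * prod_list ts)"
      using det_similar[OF sim'] det_four_block_schur[OF a xyR(1) yR] Cons.prems(5) by auto
    then have detS: "det ?S = prod_list ts * prod_list ts" using a by simp
    have "distinct ts" "0 \<notin> set ts" using Cons.prems by auto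
    from Cons.hyps[OF this ne S detS ns'] obtain X Y where
      XY: "X \<in> carrier_mat ?m ?m" "Y \<in> carrier_mat ?m ?m" "?S = X * Y"
        "similar_mat X (mk_diagonal ts)" "similar_mat Y (mk_diagonal ts)" by blast
    define L where "L = four_block_mat ?b (0\<^sub>m 1 ?m) (inverse b \<cdot>\<^sub>m x) X"
    define U where "U = four_block_mat ?b (inverse b \<cdot>\<^sub>m y') (0\<^sub>m ?m 1) Y"
    have LU: "four_block_mat (mat 1 1 (\<lambda>_. ?a)) y' x R' = L * U"
      unfolding L_def U_def
      by (rule four_block_factor[OF b(1) xyR(1) yR(1) XY(1,2) yR(2) XY(3) b(1)])
    have L: "similar_mat L (mk_diagonal (b # ts))" unfolding L_def
      using xyR by (intro similar_mk_diagonal_lower_block[OF XY(4,1) refl b(2)]) auto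
    have U: "similar_mat U (mk_diagonal (b # ts))" unfolding U_def
      using yR by (intro similar_mk_diagonal_upper_block[OF XY(5,2) refl b(2)]) auto
    have cLU: "L \<in> carrier_mat ?n ?n" "U \<in> carrier_mat ?n ?n"
      using XY(1,2) unfolding L_def U_def by auto
    obtain P Q where PQ: "similar_mat_wit A (L * U) P Q"
      using sim' unfolding LU similar_mat_def by blast
    note D = similar_mat_witD2[OF A PQ]
    \<comment> \<open>Only a conjugate of \<open>A\<close> has been factored; conjugating
      \<open>L\<close> and \<open>U\<close> back keeps their similarity classes.\<close>
    have sc: "similar_mat (P * Z * Q) Z" if "Z \<in> carrier_mat ?n ?n" for Z
      using that D by (intro similar_matI[of _ _ P Q ?n]) auto
    have "A = (P * L * Q) * (P * U * Q)"
      using conj_mult[OF cLU D(6,7,2)] D(3) by simp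
    then show ?thesis
      using similar_mat_trans[OF sc[OF cLU(1)] L] similar_mat_trans[OF sc[OF cLU(2)] U] D(6,7) cLU
      by (intro exI[of _ "P * L * Q"] exI[of _ "P * U * Q"] conjI) simp_all
  qed
qed simp

section \<open>Diagonal commutators\<close>


definition mat2 :: "'a \<Rightarrow> 'a \<Rightarrow> 'a \<Rightarrow> 'a \<Rightarrow> 'a mat" where
  "mat2 a b c d = mat 2 2 (\<lambda>(i, j). if i = 0 then if j = 0 then a else b else if j = 0 then c else d)"

lemma mat2_carrier [simp]: "mat2 a b c d \<in> carrier_mat 2 2"
  by (simp add: mat2_def)

lemma mat2_mult:
  "mat2 a b c d * mat2 a' b' c' d' =
    mat2 (a * a' + b * c') (a * b' + b * d') (c * a' + d * c') (c * b' + d * d' :: 'a::comm_ring_1)"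
  by (rule eq_matI) (auto simp: mat2_def scalar_prod_def numeral_2_eq_2)

lemma mat2_one: "1\<^sub>m 2 = mat2 1 0 0 1"
  by (rule eq_matI) (auto simp: mat2_def less_2_cases_iff)

lemma mk_diagonal_mat2: "mk_diagonal [a, b] = mat2 a 0 0 b"
  by (rule eq_matI) (auto simp: mat2_def mk_diagonal_eq less_2_cases_iff)

text \<open>\<open>t\<close> and \<open>u\<close> are the roots of the characteristic polynomial,
  and the columns of \<open>?P\<close> are eigenvectors for them; \<open>t \<noteq> u\<close> and
  \<open>g \<noteq> 0\<close> make \<open>?P\<close> invertible.\<close>

lemma mat2_similar_diagonal:
  fixes e f g h t u :: "'a::field"
  assumes "t + u = e + h" "t * u = e * h - f * g" "t \<noteq> u" "g \<noteq> 0"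
  shows "similar_mat (mat2 e f g h) (mk_diagonal [t, u])"
proof -
  let ?P = "mat2 (t - h) (u - h) g g"
  let ?Q = "mat2 (1 / (t - u)) (- (u - h) / (g * (t - u))) (- 1 / (t - u)) ((t - h) / (g * (t - u)))"
  have d: "t - u \<noteq> 0" using assms by simp
  have e: "e = t + u - h" using assms(1) by (simp add: algebra_simps)
  have "f * g = - ((t - h) * (u - h))" using assms(2) unfolding e by (simp add: algebra_simps)
  then have f: "f = - ((t - h) * (u - h)) / g" using assms(4) by (simp add: field_simps)
  have 1: "?P * ?Q = 1\<^sub>m 2" unfolding mat2_mult mat2_one
    using d assms(4) by (intro arg_cong4[where f = mat2]) (simp_all add: divide_simps, simp_all add: algebra_simps)
  have 2: "mat2 e f g h = ?P * mk_diagonal [t, u] * ?Q" unfolding mk_diagonal_mat2 mat2_mult e f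
    using d assms(4) by (intro arg_cong4[where f = mat2]) (simp_all add: divide_simps, simp_all add: algebra_simps)
  show ?thesis
    by (rule similar_matI[of _ _ ?P ?Q 2, OF _ 1 mat_mult_left_right_inverse[OF _ _ 1] 2])
      (simp_all add: mk_diagonal_mat2)
qed

text \<open>For \<open>p \<noteq> 0\<close> this is the rotation by \<open>x\<close> conjugated by
  \<open>diag(p, 1)\<close>.\<close>

definition rot2 :: "real \<Rightarrow> real \<Rightarrow> real mat" where
  "rot2 p x = mat2 (cos x) (- p * sin x) (sin x / p) (cos x)"

lemma rot2_carrier [simp]: "rot2 p x \<in> carrier_mat 2 2"
  by (simp add: rot2_def)

lemma rot2_mult: "p \<noteq> 0 \<Longrightarrow> rot2 p x * rot2 p y = rot2 p (x + y)"
  unfolding rot2_def mat2_mult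
  by (intro arg_cong4[where f = mat2]) (simp_all add: cos_add sin_add field_simps)

lemma rot2_zero: "rot2 p 0 = 1\<^sub>m 2"
  by (simp add: rot2_def mat2_one)

lemma rot2_pow: "p \<noteq> 0 \<Longrightarrow> rot2 p x ^\<^sub>m k = rot2 p (real k * x)"
proof (induct k)
  case 0
  show ?case by (simp add: rot2_zero carrier_matD[OF rot2_carrier])
next
  case (Suc k)
  then show ?case by (simp add: rot2_mult algebra_simps)
qed

lemma rot2_period: "p \<noteq> 0 \<Longrightarrow> k > 0 \<Longrightarrow> rot2 p (2 * pi / real k) ^\<^sub>m k = 1\<^sub>m 2"
  by (subst rot2_pow) (simp_all add: rot2_def mat2_one)

text \<open>The commutator \<open>M\<close> has determinant 1, and \<open>p\<close> is tuned so that
  its trace is \<open>r\<^sup>2 + 1 / r\<^sup>2\<close>. Odd \<open>k\<close> keeps both the sine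
  and the cosine of the angle away from 0: the sine so that \<open>p\<close> can be found, both so
  that the lower left entry of \<open>M\<close> does not vanish.\<close>

lemma diag2_commutator_odd:
  fixes r :: real
  assumes k: "odd k" "k \<ge> 3" and r: "r > 1"
  shows "mk_diagonal [r\<^sup>2, 1 / r\<^sup>2] \<in> commutators_of_order (GL TYPE(real) 2) k"
proof -
  have inv1: "1 / y < 1" if "1 < y" for y :: real using that by simp
  define x where "x = 2 * pi / real k"
  define c where "c = cos x"
  define s where "s = sin x"
  have cs: "c * c + s * s = 1"
    unfolding c_def s_def using sin_cos_squared_add2[of x] by (simp add: power2_eq_square)
  \<comment> \<open>A vanishing cosine would force \<open>k dvd 4\<close>.\<close>
  have c0: "c \<noteq> 0"
  proof
    assume "c = 0"
    then obtain i :: int where i: "x = of_int i * (pi / 2)"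
      unfolding c_def cos_zero_iff_int by blast
    then have "real_of_int (i * int k) = 4" using k unfolding x_def by (simp add: field_simps)
    then have "i * int k = 4" by linarith
    then have "int k dvd 4" by (metis dvd_triv_right)
    then have "k dvd 4" by presburger
    then have "k \<le> 4" by (rule dvd_imp_le) simp
    with k have "k = 3" by presburger
    with \<open>k dvd 4\<close> show False by simp
  qed
  have s0: "s \<noteq> 0"
  proof
    assume "s = 0"
    then obtain i :: int where i: "x = of_int i * pi"
      unfolding s_def sin_zero_iff_int2 by blast
    then have "real_of_int (i * int k) = 2" using k unfolding x_def by (simp add: field_simps)
    then have "i * int k = 2" by linarith
    then have "int k dvd 2" by (metis dvd_triv_right)
    then have "int k \<le> 2" by (rule zdvd_imp_le) simp
    with k show False by simp
  qed
  \<comment> \<open>The square of \<open>w\<close> is the desired trace minus 2.\<close>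
  define w where "w = r - 1 / r"
  have w: "w > 0" using r unfolding w_def by (simp add: field_simps) (metis less_1_mult)
  define m where "m = w / (s * s)"
  \<comment> \<open>The positive root of \<open>p * p = m * p + 1\<close>, which gives
    \<open>p - 1 / p = m\<close>.\<close>
  define p where "p = (m + sqrt (m\<^sup>2 + 4)) / 2"
  have m: "m > 0" using w s0 unfolding m_def by (auto intro!: divide_pos_pos simp: zero_less_mult_iff)
  have p: "p > 0" unfolding p_def using m by (intro divide_pos_pos add_pos_nonneg) auto
  have "p * p = m * p + 1"
  proof -
    have "sqrt (m\<^sup>2 + 4) * sqrt (m\<^sup>2 + 4) = m\<^sup>2 + 4" by simp
    then show ?thesis unfolding p_def by (simp add: field_simps power2_eq_square)
  qed
  then have "p - 1 / p = m" using p by (simp add: field_simps)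
  then have pw: "s * s * (p - 1 / p) = w" using s0 by (simp add: m_def)
  \<comment> \<open>Up to signs, \<open>A\<close>, \<open>U\<close>, \<open>V\<close>,
    \<open>D\<close> are the entries both of the product of the two rotations and of the product of
    their inverses.\<close>
  define A where "A = c * c - s * s / p"
  define D where "D = c * c - s * s * p"
  define U where "U = c * s * (p + 1)"
  define V where "V = c * s * (1 + 1 / p)"
  have AD: "A - D = w" using pw unfolding A_def D_def by (simp add: algebra_simps)
  \<comment> \<open>This is the determinant of a product of two rotations.\<close>
  have "A * D + U * V = (c * c + s * s) * (c * c + s * s)"
    unfolding A_def D_def U_def V_def using p by (simp add: field_simps)
  then have ADUV: "A * D + U * V = 1" using cs by simp
  have V: "V \<noteq> 0" unfolding V_def using c0 s0 p by (simp add: add_pos_pos less_imp_neq[symmetric] add_nonneg_eq_0_iff)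
  define M where "M = rot2 1 x * rot2 p x * rot2 1 (- x) * rot2 p (- x)"
  have "M \<in> commutators_of_order (GL TYPE(real) 2) k"
    using k p unfolding M_def
    by (intro commutators_of_orderI) (simp_all add: rot2_mult rot2_zero rot2_period[of _ k, folded x_def])
  moreover have "M = mat2 (A * A + U * V) (U * (A - D)) (V * (A - D)) (D * D + U * V)"
  proof -
    have "rot2 1 x * rot2 p x = mat2 A (- U) V D"
      using p unfolding rot2_def mat2_mult A_def D_def U_def V_def
      by (intro arg_cong4[where f = mat2]) (simp_all add: c_def s_def field_simps)
    moreover have "rot2 1 (- x) * rot2 p (- x) = mat2 A U (- V) D"
      using p unfolding rot2_def mat2_mult A_def D_def U_def V_def
      by (intro arg_cong4[where f = mat2]) (simp_all add: c_def s_def field_simps)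
    moreover have "M = (rot2 1 x * rot2 p x) * (rot2 1 (- x) * rot2 p (- x))"
      unfolding M_def by (rule assoc_mult_mat[of _ 2 2 _ 2 _ 2]) (auto intro!: mult_carrier_mat[of _ 2 2])
    ultimately show ?thesis
      by (simp add: mat2_mult algebra_simps)
  qed
  moreover have "similar_mat (mat2 (A * A + U * V) (U * (A - D)) (V * (A - D)) (D * D + U * V)) (mk_diagonal [r\<^sup>2, 1 / r\<^sup>2])"
  proof (rule mat2_similar_diagonal)
    have "A * A + U * V + (D * D + U * V) = (A - D) * (A - D) + 2 * (A * D + U * V)"
      by (simp add: algebra_simps)
    also have "\<dots> = r\<^sup>2 + 1 / r\<^sup>2"
      unfolding AD ADUV w_def using r by (simp add: field_simps power2_eq_square)
    finally show "r\<^sup>2 + 1 / r\<^sup>2 = A * A + U * V + (D * D + U * V)" by simp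
    have "(A * A + U * V) * (D * D + U * V) - U * (A - D) * (V * (A - D)) = (A * D + U * V) * (A * D + U * V)"
      by (simp add: algebra_simps)
    then show "r\<^sup>2 * (1 / r\<^sup>2) = (A * A + U * V) * (D * D + U * V) - U * (A - D) * (V * (A - D))"
      using ADUV r by simp
    have "r\<^sup>2 > 1" using r by (simp add: one_less_power)
    then have "1 / r\<^sup>2 < 1" by (rule inv1)
    then show "r\<^sup>2 \<noteq> 1 / r\<^sup>2" using \<open>r\<^sup>2 > 1\<close> by linarith
    show "V * (A - D) \<noteq> 0" using V AD w by simp
  qed
  ultimately show ?thesis using commutators_of_order_similar[OF similar_mat_sym] by metis
qed

text \<open>Since \<open>?a\<close> and \<open>?b\<close> are their own inverses, their commutator
  is the square of \<open>?a * ?b\<close>, which is \<open>diag(r, 1/r)\<close>.\<close>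

lemma diag2_commutator_involutions:
  fixes r :: real
  assumes r: "r > 1"
  shows "mk_diagonal [r\<^sup>2, 1 / r\<^sup>2] \<in> commutators_of_order (GL TYPE(real) 2) 2"
proof (rule commutators_of_orderI)
  let ?a = "mat2 0 1 1 0 :: real mat" and ?b = "mat2 0 (1 / r) r 0"
  show a: "?a * ?a = 1\<^sub>m 2" and b: "?b * ?b = 1\<^sub>m 2"
    using r by (simp_all add: mat2_mult mat2_one)
  show "?a ^\<^sub>m 2 = 1\<^sub>m 2" "?b ^\<^sub>m 2 = 1\<^sub>m 2"
    using a b by (simp_all add: numeral_2_eq_2)
  show "mk_diagonal [r\<^sup>2, 1 / r\<^sup>2] = ?a * ?b * ?a * ?b"
    by (simp add: mat2_mult mk_diagonal_mat2 power2_eq_square)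
qed simp_all

text \<open>Involutions settle every even \<open>k\<close>, in particular 2 and 4, where the
  rotation angle has vanishing sine or cosine.\<close>

lemma diag2_commutator:
  fixes r :: real
  assumes "k \<ge> 2" "r > 1"
  shows "mk_diagonal [r\<^sup>2, 1 / r\<^sup>2] \<in> commutators_of_order (GL TYPE(real) 2) k"
proof (cases "even k")
  case True
  then show ?thesis
    by (rule commutators_of_order_dvd[OF diag2_commutator_involutions[OF assms(2)]])
next
  case False
  then have "k \<ge> 3" using assms(1) by (cases "k = 2") auto
  then show ?thesis using False assms(2) by (intro diag2_commutator_odd)
qed

section \<open>The diagonal commutator in size n and nonscalar matrices\<close>

lemma distinct_diagonal_commutator:
  assumes k: "k \<ge> 2"
  shows "\<exists>ts :: real list. length ts = n \<and> distinct ts \<and> (\<forall>t \<in> set ts. t > 0) \<and> prod_list ts = 1 \<and>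
    mk_diagonal ts \<in> commutators_of_order (GL TYPE(real) n) k"
\<comment> \<open>Two diagonal entries are added at a time, starting from the identity matrices of
  size 0 and 1.\<close>
proof (induct n rule: induct_nat_012)
  case 0
  have "mk_diagonal [] = (1\<^sub>m 0 :: real mat)" by (auto simp: mk_diagonal_Nil)
  then show ?case using one_in_commutators_of_order[of 0 k] by (intro exI[of _ "[]"]) simp
next
  case 1
  have "mk_diagonal [1] = (1\<^sub>m (Suc 0) :: real mat)" by (auto simp: mk_diagonal_single)
  then show ?case using one_in_commutators_of_order[of "Suc 0" k] by (intro exI[of _ "[1]"]) simp
next
  case (ge2 n)
  then obtain ts :: "real list" where ts: "length ts = n" "distinct ts" "\<forall>t \<in> set ts. t > 0"
    "prod_list ts = 1" "mk_diagonal ts \<in> commutators_of_order (GL TYPE(real) n) k" by blast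
  \<comment> \<open>With \<open>r\<close> above 1, all earlier entries and all their reciprocals,
    the new entries \<open>r\<^sup>2\<close> and \<open>1 / r\<^sup>2\<close> lie strictly above and
    below all earlier ones, so the list stays distinct.\<close>
  define r where "r = 1 + Max (insert 1 (set ts \<union> (\<lambda>t. 1 / t) ` set ts))"
  have le: "x < r" if "x \<in> insert 1 (set ts \<union> (\<lambda>t. 1 / t) ` set ts)" for x
  proof -
    have "x \<le> Max (insert 1 (set ts \<union> (\<lambda>t. 1 / t) ` set ts))" using that by (intro Max_ge) auto
    then show ?thesis unfolding r_def by simp
  qed
  have r: "1 < r" by (rule le) simp
  then have r2: "r < r\<^sup>2" by (simp add: power2_eq_square)
  have big: "t < r\<^sup>2" "1 / r\<^sup>2 < t" if "t \<in> set ts" for t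
  proof -
    show "t < r\<^sup>2" using le[of t] that r2 by simp
    have "1 / t < r\<^sup>2" using le[of "1 / t"] that r2 by force
    then show "1 / r\<^sup>2 < t" using ts(3) that r r2 by (simp add: field_simps)
  qed
  let ?us = "[r\<^sup>2, 1 / r\<^sup>2] @ ts"
  have "1 / r\<^sup>2 < 1" "r\<^sup>2 > 1" using r r2 by simp_all
  then have "distinct ?us" using big ts(2) by (auto dest: big)
  moreover have "mk_diagonal ?us \<in> commutators_of_order (GL TYPE(real) (2 + n)) k"
    using commutators_of_order_four_block[OF diag2_commutator[OF k r] ts(5)]
    unfolding mk_diagonal_append by (simp add: ts(1) numeral_2_eq_2)
  ultimately show ?case using ts r by (intro exI[of _ ?us]) simp
qed

text \<open>Applying the embedding of the reals entrywise is a ring homomorphism, so the real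
  construction also serves the complex case.\<close>

lemma commutators_of_order_of_real:
  assumes "M \<in> commutators_of_order (GL TYPE(real) n) k"
  shows "map_mat of_real M \<in> commutators_of_order (GL TYPE('a::real_field) n) k"
proof -
  obtain a a' b b' where *: "a \<in> carrier_mat n n" "a' \<in> carrier_mat n n" "b \<in> carrier_mat n n"
     "b' \<in> carrier_mat n n" "a * a' = 1\<^sub>m n" "b * b' = 1\<^sub>m n"
     "a ^\<^sub>m k = 1\<^sub>m n" "b ^\<^sub>m k = 1\<^sub>m n" "M = a * b * a' * b'"
    using assms by (rule commutators_of_orderE)
  let ?h = "map_mat (of_real :: real \<Rightarrow> 'a)"
  note hm = of_real_hom.mat_hom_mult[of _ n n _ n]
  show ?thesis
  proof (rule commutators_of_orderI)
    show "?h a \<in> carrier_mat n n" "?h a' \<in> carrier_mat n n" "?h b \<in> carrier_mat n n" "?h b' \<in> carrier_mat n n"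
      using * by auto
    show "?h a * ?h a' = 1\<^sub>m n" "?h b * ?h b' = 1\<^sub>m n"
      using hm[OF *(1,2), symmetric] hm[OF *(3,4), symmetric]
      unfolding *(5,6) of_real_hom.mat_hom_one by - assumption+
    show "?h a ^\<^sub>m k = 1\<^sub>m n" "?h b ^\<^sub>m k = 1\<^sub>m n"
      using of_real_hom.mat_hom_pow[OF *(1), of k, symmetric] of_real_hom.mat_hom_pow[OF *(3), of k, symmetric]
      unfolding *(7,8) of_real_hom.mat_hom_one by - assumption+
    show "?h M = ?h a * ?h b * ?h a' * ?h b'"
      unfolding *(9)
      by (simp only: hm[OF *(1,3)] hm[OF mult_carrier_mat[OF *(1,3)] *(2)]
          hm[OF mult_carrier_mat[OF mult_carrier_mat[OF *(1,3)] *(2)] *(4)])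
  qed
qed

text \<open>The prescribed eigenvalues are the entries of the diagonal commutator. Their product is
  1, which matches \<open>det A = 1\<close>, and each factor is similar to a commutator.\<close>

lemma nonscalar_two_commutators:
  fixes A :: "'a::real_field mat"
  assumes k: "k \<ge> 2" and A: "A \<in> SL TYPE('a) n" and ns: "\<And>c. A \<noteq> c \<cdot>\<^sub>m 1\<^sub>m n"
  obtains X Y where "X \<in> commutators_of_order (GL TYPE('a) n) k" "Y \<in> commutators_of_order (GL TYPE('a) n) k"
    "A = X * Y"
proof -
  have Ac: "A \<in> carrier_mat n n" "det A = 1" using A by (auto simp: SL_def)
  obtain ts :: "real list" where ts: "length ts = n" "distinct ts" "\<forall>t \<in> set ts. t > 0"
    "prod_list ts = 1" "mk_diagonal ts \<in> commutators_of_order (GL TYPE(real) n) k"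
    using distinct_diagonal_commutator[OF k, of n] by blast
  define us where "us = map (of_real :: real \<Rightarrow> 'a) ts"
  have len: "length us = n" using ts by (simp add: us_def)
  have "mk_diagonal us = map_mat of_real (mk_diagonal ts)"
    by (intro eq_matI) (auto simp: us_def mk_diagonal_eq)
  then have D: "mk_diagonal us \<in> commutators_of_order (GL TYPE('a) n) k"
    using commutators_of_order_of_real[OF ts(5)] by simp
  have pr: "prod_list us = of_real (prod_list ts)" unfolding us_def by (induct ts) auto
  have n: "us \<noteq> []"
  proof
    assume "us = []"
    then have "A = 0 \<cdot>\<^sub>m 1\<^sub>m n" using Ac len by (intro eq_matI) auto
    with ns[of 0] show False by (rule notE)
  qed
  have d: "distinct us" using ts(2) unfolding us_def by (simp add: distinct_map inj_on_def)
  have z: "0 \<notin> set us" using ts(3) unfolding us_def by auto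
  have "\<exists>X Y. X \<in> carrier_mat (length us) (length us) \<and> Y \<in> carrier_mat (length us) (length us) \<and>
    A = X * Y \<and> similar_mat X (mk_diagonal us) \<and> similar_mat Y (mk_diagonal us)"
    using Ac ns len pr ts(4)
    by (intro nonscalar_factor_similar_mk_diagonal[OF d z n]) auto
  then obtain X Y where XY: "A = X * Y" "similar_mat X (mk_diagonal us)" "similar_mat Y (mk_diagonal us)"
    by blast
  show ?thesis
    by (rule that[OF commutators_of_order_similar[OF XY(2) D] commutators_of_order_similar[OF XY(3) D] XY(1)])
qed

section \<open>Scalar matrices\<close>


definition monomial_mat :: "nat \<Rightarrow> (nat \<Rightarrow> nat) \<Rightarrow> (nat \<Rightarrow> 'a::comm_ring_1) \<Rightarrow> 'a mat" where
  "monomial_mat n \<sigma> s = mat n n (\<lambda>(i, j). if j = \<sigma> i then s i else 0)"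

lemma monomial_mat_carrier [simp]: "monomial_mat n \<sigma> s \<in> carrier_mat n n"
  by (simp add: monomial_mat_def)

lemma monomial_mat_cong:
  "(\<And>i. i < n \<Longrightarrow> \<sigma> i = \<tau> i) \<Longrightarrow> (\<And>i. i < n \<Longrightarrow> s i = t i) \<Longrightarrow>
    monomial_mat n \<sigma> s = monomial_mat n \<tau> t"
  by (rule eq_matI) (auto simp: monomial_mat_def)

lemma monomial_mat_mult:
  assumes "\<And>i. i < n \<Longrightarrow> \<sigma> i < n"
  shows "monomial_mat n \<sigma> s * monomial_mat n \<tau> t =
    monomial_mat n (\<lambda>i. \<tau> (\<sigma> i)) (\<lambda>i. s i * t (\<sigma> i))"
proof (rule eq_matI)
  fix i j assume "i < dim_row (monomial_mat n (\<lambda>i. \<tau> (\<sigma> i)) (\<lambda>i. s i * t (\<sigma> i)))"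
    and "j < dim_col (monomial_mat n (\<lambda>i. \<tau> (\<sigma> i)) (\<lambda>i. s i * t (\<sigma> i)))"
  then have ij: "i < n" "j < n" by (simp_all add: monomial_mat_def)
  have "(monomial_mat n \<sigma> s * monomial_mat n \<tau> t) $$ (i, j) =
    (\<Sum>l = 0..<n. (if l = \<sigma> i then s i else 0) * (if j = \<tau> l then t l else 0))"
    using ij by (simp add: monomial_mat_def scalar_prod_def)
  also have "\<dots> = (\<Sum>l = 0..<n. if l = \<sigma> i then s i * (if j = \<tau> l then t l else 0) else 0)"
    by (intro sum.cong) auto
  also have "\<dots> = monomial_mat n (\<lambda>i. \<tau> (\<sigma> i)) (\<lambda>i. s i * t (\<sigma> i)) $$ (i, j)"
    using ij assms by (simp add: monomial_mat_def)
  finally show "(monomial_mat n \<sigma> s * monomial_mat n \<tau> t) $$ (i, j) =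
    monomial_mat n (\<lambda>i. \<tau> (\<sigma> i)) (\<lambda>i. s i * t (\<sigma> i)) $$ (i, j)" .
qed (simp_all add: monomial_mat_def)

lemma smult_one_monomial_mat: "c \<cdot>\<^sub>m 1\<^sub>m n = monomial_mat n (\<lambda>i. i) (\<lambda>_. c)"
  by (rule eq_matI) (auto simp: monomial_mat_def)

lemma one_monomial_mat: "1\<^sub>m n = monomial_mat n (\<lambda>i. i) (\<lambda>_. 1)"
  by (rule eq_matI) (auto simp: monomial_mat_def)

text \<open>The first two hypotheses make both matrices involutions, so the commutator is
  \<open>?a * ?b * ?a * ?b\<close>. By \<open>comm\<close> its underlying permutation is trivial,
  and \<open>u\<close> collects the coefficients met along the way.\<close>

lemma monomial_mat_commutator:
  fixes s t :: "nat \<Rightarrow> 'a::field"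
  assumes \<sigma>: "\<And>i. i < n \<Longrightarrow> \<sigma> i < n \<and> \<sigma> (\<sigma> i) = i \<and> s i * s (\<sigma> i) = 1"
    and \<tau>: "\<And>i. i < n \<Longrightarrow> \<tau> i < n \<and> \<tau> (\<tau> i) = i \<and> t i * t (\<tau> i) = 1"
    and comm: "\<And>i. i < n \<Longrightarrow> \<tau> (\<sigma> (\<tau> (\<sigma> i))) = i"
    and u: "\<And>i. i < n \<Longrightarrow> u i = s i * t (\<sigma> i) * s (\<tau> (\<sigma> i)) * t (\<sigma> (\<tau> (\<sigma> i)))"
  shows "monomial_mat n (\<lambda>i. i) u \<in> commutators_of_order (GL TYPE('a) n) 2"
proof (rule commutators_of_orderI)
  let ?a = "monomial_mat n \<sigma> s" and ?b = "monomial_mat n \<tau> t"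
  have a: "?a * ?a = 1\<^sub>m n"
    unfolding one_monomial_mat by (subst monomial_mat_mult) (auto simp: \<sigma> intro!: monomial_mat_cong)
  have b: "?b * ?b = 1\<^sub>m n"
    unfolding one_monomial_mat by (subst monomial_mat_mult) (auto simp: \<tau> intro!: monomial_mat_cong)
  show "?a * ?a = 1\<^sub>m n" "?b * ?b = 1\<^sub>m n" by (fact a, fact b)
  show "?a ^\<^sub>m 2 = 1\<^sub>m n" "?b ^\<^sub>m 2 = 1\<^sub>m n"
    using a b by (simp_all add: numeral_2_eq_2 left_mult_one_mat[OF monomial_mat_carrier] carrier_matD[OF monomial_mat_carrier])
  show "monomial_mat n (\<lambda>i. i) u = ?a * ?b * ?a * ?b"
    by (simp add: monomial_mat_mult \<sigma> \<tau>) (auto intro!: monomial_mat_cong simp: comm u)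
qed simp_all

text \<open>The reversal of the indices exchanges the two halves, on which the diagonal involution
  has opposite signs, so every index picks up one factor -1.\<close>

lemma real_neg_one_commutator:
  assumes "even n"
  shows "(- 1) \<cdot>\<^sub>m 1\<^sub>m n \<in> commutators_of_order (GL TYPE(real) n) 2"
  unfolding smult_one_monomial_mat
proof (rule monomial_mat_commutator)
  let ?\<sigma> = "\<lambda>i. n - 1 - i" and ?t = "\<lambda>i. if 2 * i < n then 1 else - 1 :: real"
  fix i assume i: "i < n"
  then show "?\<sigma> i < n \<and> ?\<sigma> (?\<sigma> i) = i \<and> 1 * 1 = (1 :: real)" by auto
  show "i < n \<and> i = i \<and> ?t i * ?t i = 1" using i by simp
  show "?\<sigma> (?\<sigma> i) = i" using i by simp
  \<comment> \<open>Evenness matters here: for odd \<open>n\<close> the reversal would fix the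
    middle index.\<close>
  have "2 * ?\<sigma> i < n \<longleftrightarrow> \<not> 2 * i < n" using i assms by presburger
  then show "- 1 = 1 * ?t (?\<sigma> i) * 1 * ?t (?\<sigma> (?\<sigma> i))" using i by simp
qed

text \<open>Multiplying the monomial involution by the plain permutation matrix of
  \<open>\<sigma>\<close> gives the diagonal matrix of \<open>s\<close>; the commutator of these two
  involutions is its square.\<close>

lemma squares_commutator:
  fixes s :: "nat \<Rightarrow> 'a::field"
  assumes "\<And>i. i < n \<Longrightarrow> \<sigma> i < n \<and> \<sigma> (\<sigma> i) = i \<and> s i * s (\<sigma> i) = 1"
  shows "monomial_mat n (\<lambda>i. i) (\<lambda>i. s i * s i) \<in> commutators_of_order (GL TYPE('a) n) 2"
  by (rule monomial_mat_commutator[of n \<sigma> s \<sigma> "\<lambda>_. 1"]) (use assms in auto)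

text \<open>
  With \<open>\<nu>\<^sup>4 = c\<close>, the diagonal matrix \<open>B\<close> with entries \<open>\<nu> powi (2 * (2 * i + 1 - n))\<close> is inverted by
  \<open>i \<mapsto> n - 1 - i\<close>. The entries \<open>\<nu> powi (2 * (n + 1 - 2 * i))\<close> of \<open>c B\<^sup>-\<^sup>1\<close> are inverted by
  \<open>i \<mapsto> n + 1 - i\<close> for \<open>i \<ge> 2\<close>, and those at \<open>0\<close> and \<open>1\<close> are mutually inverse since \<open>\<nu>\<^sup>4\<close> is an
  \<open>n\<close>-th root of unity.
\<close>

lemma complex_scalar_two_commutators:
  fixes c :: complex
  assumes c: "c ^ n = 1" and n: "n \<ge> 2"
  obtains X Y where "X \<in> commutators_of_order (GL TYPE(complex) n) 2"
    "Y \<in> commutators_of_order (GL TYPE(complex) n) 2" "c \<cdot>\<^sub>m 1\<^sub>m n = X * Y"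
proof -
  define \<nu> where "\<nu> = csqrt (csqrt c)"
  have "\<nu> ^ 4 = (\<nu>\<^sup>2)\<^sup>2" by (simp add: power_mult[symmetric])
  then have \<nu>4: "\<nu> ^ 4 = c" by (simp add: \<nu>_def)
  have c0: "c \<noteq> 0" using c n by (auto simp: power_0_left)
  then have \<nu>: "\<nu> \<noteq> 0" using \<nu>4 by auto
  have add: "\<nu> powi a * \<nu> powi b = \<nu> powi (a + b)" for a b
    using \<nu> by (simp add: power_int_add)
  have p4: "\<nu> powi 4 = c" using \<nu>4 by simp
  have p4n: "\<nu> powi (4 - 4 * int n) = c"
  proof -
    have "\<nu> powi (4 * int n) = (\<nu> ^ 4) ^ n" 
      unfolding power_int_mult by (simp)
    then have "\<nu> powi (4 * int n) = 1" using \<nu>4 c by simp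
    then show ?thesis using \<nu> p4 by (simp add: power_int_diff)
  qed
  define s where "s = (\<lambda>i. \<nu> powi (2 * int i + 1 - int n))"
  \<comment> \<open>At index 1 the generic exponent \<open>n - 1\<close> is lowered by
    \<open>2 * n\<close>, which makes \<open>s' 1\<close> inverse to \<open>s' 0\<close>. The
    squares still agree, because \<open>\<nu> powi (4 * int n) = 1\<close>; \<open>p4n\<close>
    accounts for this shift.\<close>
  define s' where "s' = (\<lambda>i. \<nu> powi (if i = 1 then - int n - 1 else int n + 1 - 2 * int i))"
  define \<sigma>' where "\<sigma>' = (\<lambda>i. if i < 2 then 1 - i else n + 1 - i)"
  have "monomial_mat n (\<lambda>i. i) (\<lambda>i. s i * s i) \<in> commutators_of_order (GL TYPE(complex) n) 2"
    by (rule squares_commutator[where \<sigma> = "\<lambda>i. n - 1 - i"]) (auto simp: s_def add of_nat_diff)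
  moreover have "monomial_mat n (\<lambda>i. i) (\<lambda>i. s' i * s' i) \<in> commutators_of_order (GL TYPE(complex) n) 2"
  proof (rule squares_commutator[where \<sigma> = \<sigma>'])
    fix i assume i: "i < n"
    consider "i = 0" | "i = 1" | "i \<ge> 2" by linarith
    then show "\<sigma>' i < n \<and> \<sigma>' (\<sigma>' i) = i \<and> s' i * s' (\<sigma>' i) = 1"
      using i n by cases (auto simp: s'_def \<sigma>'_def add of_nat_diff)
  qed
  moreover have "c \<cdot>\<^sub>m 1\<^sub>m n = monomial_mat n (\<lambda>i. i) (\<lambda>i. s i * s i) * monomial_mat n (\<lambda>i. i) (\<lambda>i. s' i * s' i)"
    unfolding smult_one_monomial_mat
  proof (subst monomial_mat_mult, simp, rule monomial_mat_cong, simp)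
    fix i assume "i < n"
    show "c = s i * s i * (s' i * s' i)"
    proof (cases "i = 1")
      case True
      then show ?thesis using p4n unfolding s_def s'_def add by (simp add: algebra_simps)
    next
      case False
      then show ?thesis using p4 unfolding s_def s'_def add by (simp add: algebra_simps)
    qed
  qed
  ultimately show ?thesis by (rule that)
qed

text \<open>A transvection times its inverse is the identity; the scalar \<open>c\<close> is
  absorbed into the second factor, whose determinant is then \<open>c ^ n = 1\<close>.\<close>

lemma scalar_product_nonscalar:
  fixes c :: "'a::field"
  assumes c: "c ^ n = 1" and n: "n \<ge> 2"
  obtains X Y where "X \<in> SL TYPE('a) n" "Y \<in> SL TYPE('a) n" "c \<cdot>\<^sub>m 1\<^sub>m n = X * Y"
    "\<forall>d. X \<noteq> d \<cdot>\<^sub>m 1\<^sub>m n" "\<forall>d. Y \<noteq> d \<cdot>\<^sub>m 1\<^sub>m n"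
proof -
  let ?X = "addrow_mat n 1 0 1 :: 'a mat" and ?Y = "c \<cdot>\<^sub>m addrow_mat n (- 1) 0 1"
  have c0: "c \<noteq> 0" using c n by (auto simp: power_0_left)
  have "?X \<in> SL TYPE('a) n" "?Y \<in> SL TYPE('a) n"
    using c n by (auto simp: SL_def det_addrow_mat det_smult)
  moreover have "?X * ?Y = c \<cdot>\<^sub>m (?X * addrow_mat n (- 1) 0 1)"
    by (rule mult_smult_distrib[of _ n n _ n]) auto
  then have "c \<cdot>\<^sub>m 1\<^sub>m n = ?X * ?Y" using addrow_mat_inv[of 0 n 1 "1 :: 'a"] n by simp
  moreover have X: "?X $$ (0, 1) = 1" and Y: "?Y $$ (0, 1) = - c"
    using n by auto
  have "\<forall>d. ?X \<noteq> d \<cdot>\<^sub>m 1\<^sub>m n"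
  proof (intro allI notI)
    fix d
    assume "?X = d \<cdot>\<^sub>m 1\<^sub>m n"
    then have "?X $$ (0, 1) = (d \<cdot>\<^sub>m 1\<^sub>m n) $$ (0, 1)" by (rule arg_cong)
    then show False unfolding X using n by simp
  qed
  moreover have "\<forall>d. ?Y \<noteq> d \<cdot>\<^sub>m 1\<^sub>m n"
  proof (intro allI notI)
    fix d
    assume "?Y = d \<cdot>\<^sub>m 1\<^sub>m n"
    then have "?Y $$ (0, 1) = (d \<cdot>\<^sub>m 1\<^sub>m n) $$ (0, 1)" by (rule arg_cong)
    then show False unfolding Y using n c0 by simp
  qed
  ultimately show ?thesis by (rule that)
qed

section \<open>Products of commutators\<close>

context monoid
begin

lemma foldr_mult_closed: "set xs \<subseteq> carrier G \<Longrightarrow> foldr (\<otimes>) xs \<one> \<in> carrier G"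
  by (induct xs) auto

lemma foldr_mult_append:
  "set xs \<subseteq> carrier G \<Longrightarrow> set ys \<subseteq> carrier G \<Longrightarrow>
    foldr (\<otimes>) (xs @ ys) \<one> = foldr (\<otimes>) xs \<one> \<otimes> foldr (\<otimes>) ys \<one>"
  by (induct xs) (auto simp: m_assoc foldr_mult_closed simp del: foldr_append)

lemma products_of_at_most_mult:
  assumes "S \<subseteq> carrier G" "x \<in> products_of_at_most G l S" "y \<in> products_of_at_most G m S"
  shows "x \<otimes> y \<in> products_of_at_most G (l + m) S"
proof -
  obtain xs ys where "x = foldr (\<otimes>) xs \<one>" "set xs \<subseteq> S" "length xs \<le> l"
    "y = foldr (\<otimes>) ys \<one>" "set ys \<subseteq> S" "length ys \<le> m"
    using assms(2,3) unfolding products_of_at_most_def by blast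
  then show ?thesis using foldr_mult_append[of xs ys] assms(1)
    unfolding products_of_at_most_def
    by (intro CollectI exI[of _ "xs @ ys"]) (auto simp del: foldr_append)
qed

lemma products_of_at_most_one: "\<one> \<in> products_of_at_most G m S"
  unfolding products_of_at_most_def by (intro CollectI exI[of _ "[]"]) simp


lemma products_of_at_most_mono:
  "l \<le> m \<Longrightarrow> products_of_at_most G l S \<subseteq> products_of_at_most G m S"
  unfolding products_of_at_most_def by fastforce

lemma products_of_at_most_single:
  "S \<subseteq> carrier G \<Longrightarrow> x \<in> S \<Longrightarrow> x \<in> products_of_at_most G 1 S"
  unfolding products_of_at_most_def by (intro CollectI exI[of _ "[x]"]) auto

end

section \<open>Counting the commutators\<close>

abbreviation (input) "GL_products TYPE_a n k m \<equiv> products_of_at_most (GL TYPE_a n) m (commutators_of_order (GL TYPE_a n) k)"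

lemma commutators_of_order_subset:
  "commutators_of_order (GL TYPE('a::field) n) k \<subseteq> carrier (GL TYPE('a) n)"
proof -
  interpret group "GL TYPE('a) n" by (rule group_GL)
  show ?thesis unfolding commutators_of_order_def elements_of_order_def by auto
qed

lemma GL_products_mult:
  fixes X Y :: "'a::field mat"
  assumes "X \<in> GL_products TYPE('a) n k l" "Y \<in> GL_products TYPE('a) n k m"
  shows "X * Y \<in> GL_products TYPE('a) n k (l + m)"
proof -
  interpret group "GL TYPE('a) n" by (rule group_GL)
  show ?thesis using products_of_at_most_mult[OF commutators_of_order_subset assms] by (simp add: GL_simps)
qed

lemma commutators_product_two:
  fixes X Y :: "'a::field mat"
  assumes "X \<in> commutators_of_order (GL TYPE('a) n) k" "Y \<in> commutators_of_order (GL TYPE('a) n) k"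
  shows "X * Y \<in> GL_products TYPE('a) n k 2"
proof -
  interpret group "GL TYPE('a) n" by (rule group_GL)
  show ?thesis
    using GL_products_mult[OF products_of_at_most_single[OF commutators_of_order_subset assms(1)]
        products_of_at_most_single[OF commutators_of_order_subset assms(2)]] by (simp only: one_add_one)
qed

text \<open>Isolates the only part that depends on the field: scalar matrices for
  \<open>k = 2\<close>, where just two commutators are allowed.\<close>

lemma SL_products_of_commutators:
  fixes A :: "'a::real_field mat"
  assumes k: "k \<ge> 2" and A: "A \<in> SL TYPE('a) n"
    and scalar: "\<And>c::'a. c ^ n = 1 \<Longrightarrow> n \<ge> 2 \<Longrightarrow> c \<cdot>\<^sub>m 1\<^sub>m n \<in> GL_products TYPE('a) n 2 2"
  shows "A \<in> GL_products TYPE('a) n k (4 * k - 6)"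
proof -
  interpret group "GL TYPE('a) n" by (rule group_GL)
  have two: "B \<in> GL_products TYPE('a) n k 2" if B: "B \<in> SL TYPE('a) n" "\<And>c. B \<noteq> c \<cdot>\<^sub>m 1\<^sub>m n" for B
  proof -
    obtain X Y where "X \<in> commutators_of_order (GL TYPE('a) n) k"
      "Y \<in> commutators_of_order (GL TYPE('a) n) k" "B = X * Y"
      by (rule nonscalar_two_commutators[OF k B])
    then show ?thesis using commutators_product_two by simp
  qed
  note mono = subsetD[OF products_of_at_most_mono]
  show ?thesis
  proof (cases "\<exists>c. A = c \<cdot>\<^sub>m 1\<^sub>m n")
    case False
    then show ?thesis using k by (intro mono[OF _ two[OF A]]) auto
  next
    case True
    then obtain c where c: "A = c \<cdot>\<^sub>m 1\<^sub>m n" by blast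
    have cn: "c ^ n = 1" using A unfolding c SL_def by (simp add: det_smult)
    \<comment> \<open>The bound \<open>4 * k - 6\<close> is 2 for \<open>k = 2\<close> and at least
      6 for larger \<open>k\<close>.\<close>
    consider "n < 2" | "n \<ge> 2" "k = 2" | "n \<ge> 2" "k \<ge> 3" using k by linarith
    then show ?thesis
    proof cases
      case 1
      \<comment> \<open>In size 0 or 1 the only scalar matrix of determinant 1 is the identity, an
        empty product.\<close>
      then have "A = \<one>\<^bsub>GL TYPE('a) n\<^esub>"
        using cn unfolding c GL_simps by (auto simp: less_2_cases_iff)
      then show ?thesis using products_of_at_most_one by simp
    next
      case 2
      then show ?thesis using scalar[OF cn] c by simp
    next
      case 3
      obtain X Y where XY: "X \<in> SL TYPE('a) n" "Y \<in> SL TYPE('a) n" "c \<cdot>\<^sub>m 1\<^sub>m n = X * Y"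
        "\<forall>d. X \<noteq> d \<cdot>\<^sub>m 1\<^sub>m n" "\<forall>d. Y \<noteq> d \<cdot>\<^sub>m 1\<^sub>m n"
        by (rule scalar_product_nonscalar[OF cn 3(1)])
      \<comment> \<open>Two commutators for each of the two nonscalar factors, hence four.\<close>
      show ?thesis unfolding c XY(3)
        using 3 by (intro mono[OF _ GL_products_mult[OF two[OF XY(1) XY(4)[rule_format]] two[OF XY(2) XY(5)[rule_format]]]]) simp
    qed
  qed
qed

theorem theorem1p2:
  fixes k n :: nat
  assumes "k \<ge> 2"
  shows "(\<forall>A \<in> SL TYPE(complex) n.
            A \<in> products_of_at_most (GL TYPE(complex) n) (4 * k - 6)
                  (commutators_of_order (GL TYPE(complex) n) k)) \<and>
         (\<forall>A \<in> SL TYPE(real) n.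
            A \<in> products_of_at_most (GL TYPE(real) n) (4 * k - 6)
                  (commutators_of_order (GL TYPE(real) n) k))"
proof (intro conjI ballI)
  fix A assume "A \<in> SL TYPE(complex) n"
  with assms show "A \<in> GL_products TYPE(complex) n k (4 * k - 6)"
  proof (rule SL_products_of_commutators)
    fix c :: complex assume "c ^ n = 1" "n \<ge> 2"
    then obtain X Y where "X \<in> commutators_of_order (GL TYPE(complex) n) 2"
      "Y \<in> commutators_of_order (GL TYPE(complex) n) 2" "c \<cdot>\<^sub>m 1\<^sub>m n = X * Y"
      by (rule complex_scalar_two_commutators)
    then show "c \<cdot>\<^sub>m 1\<^sub>m n \<in> GL_products TYPE(complex) n 2 2"
      using commutators_product_two by simp
  qed
next
  fix A assume "A \<in> SL TYPE(real) n"
  with assms show "A \<in> GL_products TYPE(real) n k (4 * k - 6)"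
  proof (rule SL_products_of_commutators)
    fix c :: real assume c: "c ^ n = 1" and n: "n \<ge> 2"
    interpret group "GL TYPE(real) n" by (rule group_GL)
    \<comment> \<open>The only real roots of unity are 1 and -1, and -1 occurs only for even
      \<open>n\<close>; in both cases a single commutator is enough.\<close>
    have "\<bar>c\<bar> ^ n = 1" using c by (simp add: power_abs[symmetric])
    then have "\<bar>c\<bar> = 1" using n by (intro power_eq_imp_eq_base[of "\<bar>c\<bar>" n 1]) auto
    then consider "c = 1" | "c = - 1" by linarith
    then have "c \<cdot>\<^sub>m 1\<^sub>m n \<in> commutators_of_order (GL TYPE(real) n) 2"
    proof cases
      case 1
      then have "c \<cdot>\<^sub>m 1\<^sub>m n = 1\<^sub>m n" by auto
      then show ?thesis using one_in_commutators_of_order by simp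
    next
      case 2
      then have "even n" using c by (cases "even n") auto
      then show ?thesis unfolding 2 by (rule real_neg_one_commutator)
    qed
    from products_of_at_most_single[OF commutators_of_order_subset this]
    show "c \<cdot>\<^sub>m 1\<^sub>m n \<in> GL_products TYPE(real) n 2 2"
      by (rule subsetD[OF products_of_at_most_mono, rotated]) simp
  qed
qed

end
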